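(* Let $G$ be a group, let $F$ be an algebraically closed field of characteristic zero, and let $A$ and $B$ be finite dimensional simple $G$-graded algebras over $F$ with presentations $P_{A}=(H_A, \alpha, (p_1,\ldots,p_r))$ and $P_{B}=(H_B, \beta, (q_1,\ldots,q_s))$, respectively. If $A$ and $B$ are isomorphic as $G$-graded algebras, then $P_A$ and $P_B$ are equivalent.
   Context: All algebras are associative. A $G$-graded algebra $A=\bigoplus_{g\in G}A_g$ (with $A_gA_h\subseteq A_{gh}$) is a simple $G$-graded algebra (or $G$-simple) if it has no nontrivial homogeneous two-sided ideals. A $G$-graded isomorphism is an $F$-algebra isomorphism preserving each homogeneous component. For a finite group $H$ and a 2-cocycle $\alpha: H\times H\to F^*$ (trivial action of $H$ on $F^*$), the twisted group algebra $F^{\alpha}H$ has $F$-basis $\{u_h\}_{h\in H}$ and product $u_hu_{h'}=\alpha(h,h')u_{hh'}$. A presentation of a finite dimensional $G$-simple algebra $A$ is a triple $P_A=(H,\alpha,(p_1,\ldots,p_r))$, where $H$ is a finite subgroup of $G$, $\alpha$ is a 2-cocycle on $H$ with values in $F^*$ (trivial action), $r\ge 1$ and $(p_1,\ldots,p_r)\in G^{r}$, such that $A$ is $G$-graded isomorphic to $C=F^{\alpha}H\otimes_F M_r(F)$ graded by $C_g=\mathrm{span}_F\{u_h\otimes e_{i,j}: g=p_i^{-1}hp_j\}$, where $e_{i,j}$ are the elementary matrices. The basic moves on a presentation $(H,\alpha,(p_1,\ldots,p_r))$ are: (1) permuting the entries of the tuple, i.e. replacing $(p_1,\dots,p_r)$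 by $(p_{\pi(1)},\dots,p_{\pi(r)})$ for some $\pi\in \mathrm{Sym}(r)$; (2) replacing an entry $p_i$ by $h_0p_i$ for some $h_0\in H$; (3) for some $g\in G$, simultaneously replacing $H$ by $gHg^{-1}$, $\alpha$ by the cocycle $\alpha^g$ on $gHg^{-1}$ defined by $\alpha^g(gh_1g^{-1},gh_2g^{-1})=\alpha(h_1,h_2)$, and $(p_1,\dots,p_r)$ by $(gp_1,\dots,gp_r)$. Two presentations are equivalent if one is obtained from the other by a finite sequence of basic moves.
   Formalization: Equivalence is taken up to coboundary: the basic moves turn P_A into (H_B, α', (q_1,…,q_s)) with α' cohomologous to β, since the moves never rescale a cocycle and literal equality fails already for H trivial with α(1,1)=1 and β(1,1)=c≠1. *)

theory Defs
  imports
    "HOL-Algebra.Algebra"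
    "HOL-Algebra.Algebraic_Closure_Type"
    "HOL-Combinatorics.Permutations"
begin

section \<open>Graded algebras\<close>

text \<open>
  The ground field \<open>F\<close> is a type of class \<^class>\<open>field\<close>; an \<open>F\<close>-algebra is a record of type
  \<open>('f, 'a) module\<close>. Algebras are associative but not assumed to have a unit, so the field
  \<^const>\<open>one\<close> of the record carries no information.
\<close>

locale assoc_algebra = module "ring_of_type_algebra :: 'f::field ring" A
  for A :: "('f::field, 'a) module" (structure) +
  assumes mult_closed: "\<lbrakk>x \<in> carrier A; y \<in> carrier A\<rbrakk> \<Longrightarrow> x \<otimes> y \<in> carrier A"
    and mult_assoc:
      "\<lbrakk>x \<in> carrier A; y \<in> carrier A; z \<in> carrier A\<rbrakk> \<Longrightarrow> (x \<otimes> y) \<otimes> z = x \<otimes> (y \<otimes> z)"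
    and distrib_left:
      "\<lbrakk>x \<in> carrier A; y \<in> carrier A; z \<in> carrier A\<rbrakk> \<Longrightarrow> x \<otimes> (y \<oplus> z) = x \<otimes> y \<oplus> x \<otimes> z"
    and distrib_right:
      "\<lbrakk>x \<in> carrier A; y \<in> carrier A; z \<in> carrier A\<rbrakk> \<Longrightarrow> (x \<oplus> y) \<otimes> z = x \<otimes> z \<oplus> y \<otimes> z"
    and smult_mult_left:
      "\<lbrakk>x \<in> carrier A; y \<in> carrier A\<rbrakk> \<Longrightarrow> (c \<odot> x) \<otimes> y = c \<odot> (x \<otimes> y)"
    and smult_mult_right:
      "\<lbrakk>x \<in> carrier A; y \<in> carrier A\<rbrakk> \<Longrightarrow> x \<otimes> (c \<odot> y) = c \<odot> (x \<otimes> y)"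

definition lin_span :: "('f, 'a) module \<Rightarrow> 'a set \<Rightarrow> 'a set"
  where "lin_span A S =
    {finsum A (\<lambda>s. c s \<odot>\<^bsub>A\<^esub> s) T | c T. finite T \<and> T \<subseteq> S}"

definition finite_dimensional :: "('f, 'a) module \<Rightarrow> bool"
  where "finite_dimensional A \<longleftrightarrow>
    (\<exists>S. finite S \<and> S \<subseteq> carrier A \<and> lin_span A S = carrier A)"

text \<open>
  \<open>c\<close> is a decomposition of \<open>x\<close> into homogeneous components: \<open>c g \<in> \<Gamma> g\<close> for all \<open>g\<close>, almost all
  \<open>c g\<close> vanish, and \<open>x\<close> is the sum of the \<open>c g\<close>. Families are extensional outside
  \<^term>\<open>carrier G\<close>, so that uniqueness makes sense.
\<close>

definition homogeneous_decomposition ::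
    "('g, 'm) monoid_scheme \<Rightarrow> ('f, 'a) module \<Rightarrow> ('g \<Rightarrow> 'a set) \<Rightarrow> 'a \<Rightarrow> ('g \<Rightarrow> 'a) \<Rightarrow> bool"
  where "homogeneous_decomposition G A \<Gamma> x c \<longleftrightarrow>
    c \<in> (\<Pi>\<^sub>E g\<in>carrier G. \<Gamma> g) \<and>
    finite {g \<in> carrier G. c g \<noteq> \<zero>\<^bsub>A\<^esub>} \<and>
    x = finsum A c {g \<in> carrier G. c g \<noteq> \<zero>\<^bsub>A\<^esub>}"

locale graded_algebra = group G + assoc_algebra A
  for G :: "('g, 'm) monoid_scheme" and A :: "('f::field, 'a) module"
    and \<Gamma> :: "'g \<Rightarrow> 'a set" +
  assumes component_submodule:
      "g \<in> carrier G \<Longrightarrow> submodule (\<Gamma> g) (ring_of_type_algebra :: 'f ring) A"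
    and component_mult:
      "\<lbrakk>g \<in> carrier G; h \<in> carrier G; x \<in> \<Gamma> g; y \<in> \<Gamma> h\<rbrakk>
        \<Longrightarrow> x \<otimes>\<^bsub>A\<^esub> y \<in> \<Gamma> (g \<otimes>\<^bsub>G\<^esub> h)"
    and direct_sum:
      "x \<in> carrier A \<Longrightarrow> \<exists>!c. homogeneous_decomposition G A \<Gamma> x c"

definition two_sided_ideal :: "('f::field, 'a) module \<Rightarrow> 'a set \<Rightarrow> bool"
  where "two_sided_ideal A I \<longleftrightarrow>
    submodule I (ring_of_type_algebra :: 'f ring) A \<and>
    (\<forall>a\<in>carrier A. \<forall>x\<in>I. a \<otimes>\<^bsub>A\<^esub> x \<in> I \<and> x \<otimes>\<^bsub>A\<^esub> a \<in> I)"

text \<open>A subspace is homogeneous if it is the sum of its intersections with the components.\<close>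

definition homogeneous ::
    "('g, 'm) monoid_scheme \<Rightarrow> ('f, 'a) module \<Rightarrow> ('g \<Rightarrow> 'a set) \<Rightarrow> 'a set \<Rightarrow> bool"
  where "homogeneous G A \<Gamma> I \<longleftrightarrow>
    (\<forall>x\<in>I. \<exists>c. homogeneous_decomposition G A (\<lambda>g. I \<inter> \<Gamma> g) x c)"

definition simple_graded_algebra ::
    "('g, 'm) monoid_scheme \<Rightarrow> ('f::field, 'a) module \<Rightarrow> ('g \<Rightarrow> 'a set) \<Rightarrow> bool"
  where "simple_graded_algebra G A \<Gamma> \<longleftrightarrow>
    graded_algebra G A \<Gamma> \<and>
    (\<forall>I. two_sided_ideal A I \<and> homogeneous G A \<Gamma> I \<longrightarrow> I = {\<zero>\<^bsub>A\<^esub>} \<or> I = carrier A)"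

definition graded_isomorphic ::
    "('g, 'm) monoid_scheme \<Rightarrow> ('f, 'a) module \<Rightarrow> ('g \<Rightarrow> 'a set) \<Rightarrow>
      ('f, 'b) module \<Rightarrow> ('g \<Rightarrow> 'b set) \<Rightarrow> bool"
  where "graded_isomorphic G A \<Gamma> B \<Delta> \<longleftrightarrow>
    (\<exists>\<phi>. bij_betw \<phi> (carrier A) (carrier B) \<and>
      (\<forall>x\<in>carrier A. \<forall>y\<in>carrier A. \<phi> (x \<oplus>\<^bsub>A\<^esub> y) = \<phi> x \<oplus>\<^bsub>B\<^esub> \<phi> y) \<and>
      (\<forall>c. \<forall>x\<in>carrier A. \<phi> (c \<odot>\<^bsub>A\<^esub> x) = c \<odot>\<^bsub>B\<^esub> \<phi> x) \<and>
      (\<forall>x\<in>carrier A. \<forall>y\<in>carrier A. \<phi> (x \<otimes>\<^bsub>A\<^esub> y) = \<phi> x \<otimes>\<^bsub>B\<^esub> \<phi> y) \<and>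
      (\<forall>g\<in>carrier G. \<phi> ` \<Gamma> g = \<Delta> g))"


section \<open>The algebra \<open>F\<^sup>\<alpha>H \<otimes> M\<^sub>r(F)\<close>\<close>

text \<open>
  The algebra with (finite) basis \<open>I\<close> and structure constants \<open>s\<close>, that is, with
  \<open>b\<^sub>i b\<^sub>j = (\<Sum>k\<in>I. s i j k b\<^sub>k)\<close>. Elements are coefficient functions supported on \<open>I\<close>.
\<close>

definition algebra_with_basis :: "'i set \<Rightarrow> ('i \<Rightarrow> 'i \<Rightarrow> 'i \<Rightarrow> 'f::field) \<Rightarrow> ('f, 'i \<Rightarrow> 'f) module"
  where "algebra_with_basis I s =
    \<lparr>carrier = {x. \<forall>k. k \<notin> I \<longrightarrow> x k = 0},
     monoid.mult = (\<lambda>x y k. if k \<in> I then \<Sum>i\<in>I. \<Sum>j\<in>I. s i j k * x i * y j else 0),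
     monoid.one = undefined,
     ring.zero = (\<lambda>_. 0),
     ring.add = (\<lambda>x y k. x k + y k),
     module.smult = (\<lambda>c x k. c * x k)\<rparr>"

definition basis_vector :: "'i \<Rightarrow> 'i \<Rightarrow> 'f::field"
  where "basis_vector i = (\<lambda>k. if k = i then 1 else 0)"

definition twisted_group_constants ::
    "('g, 'm) monoid_scheme \<Rightarrow> ('g \<Rightarrow> 'g \<Rightarrow> 'f) \<Rightarrow> 'g \<Rightarrow> 'g \<Rightarrow> 'g \<Rightarrow> 'f::field"
  where "twisted_group_constants G \<alpha> h h' k = (if k = h \<otimes>\<^bsub>G\<^esub> h' then \<alpha> h h' else 0)"

definition matrix_constants :: "nat \<times> nat \<Rightarrow> nat \<times> nat \<Rightarrow> nat \<times> nat \<Rightarrow> 'f::field"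
  where "matrix_constants = (\<lambda>(i, j) (k, l) e. if j = k \<and> e = (i, l) then 1 else 0)"

text \<open>
  The tensor product of algebras with bases \<open>I\<close> and \<open>J\<close> has basis \<open>I \<times> J\<close> and the products of
  the structure constants as its structure constants.
\<close>

definition tensor_constants ::
    "('i \<Rightarrow> 'i \<Rightarrow> 'i \<Rightarrow> 'f) \<Rightarrow> ('j \<Rightarrow> 'j \<Rightarrow> 'j \<Rightarrow> 'f) \<Rightarrow>
      'i \<times> 'j \<Rightarrow> 'i \<times> 'j \<Rightarrow> 'i \<times> 'j \<Rightarrow> 'f::field"
  where "tensor_constants s t = (\<lambda>(i, i') (j, j') (k, k'). s i j k * t i' j' k')"

definition twisted_matrix_algebra ::
    "('g, 'm) monoid_scheme \<Rightarrow> 'g set \<Rightarrow> ('g \<Rightarrow> 'g \<Rightarrow> 'f) \<Rightarrow> nat \<Rightarrow>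
      ('f::field, 'g \<times> nat \<times> nat \<Rightarrow> 'f) module"
  where "twisted_matrix_algebra G H \<alpha> r =
    algebra_with_basis (H \<times> ({..<r} \<times> {..<r}))
      (tensor_constants (twisted_group_constants G \<alpha>) matrix_constants)"

definition twisted_matrix_grading ::
    "('g, 'm) monoid_scheme \<Rightarrow> 'g set \<Rightarrow> ('g \<Rightarrow> 'g \<Rightarrow> 'f) \<Rightarrow> 'g list \<Rightarrow>
      'g \<Rightarrow> ('g \<times> nat \<times> nat \<Rightarrow> 'f::field) set"
  where "twisted_matrix_grading G H \<alpha> ps g =
    lin_span (twisted_matrix_algebra G H \<alpha> (length ps))
      {basis_vector (h, i, j) | h i j. h \<in> H \<and> i < length ps \<and> j < length ps \<and>
         g = inv\<^bsub>G\<^esub> (ps ! i) \<otimes>\<^bsub>G\<^esub> h \<otimes>\<^bsub>G\<^esub> ps ! j}"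

lemma basis_vector_mult:
  assumes G: "group G" and H: "subgroup H G" "finite H"
    and h: "h \<in> H" "h' \<in> H" and ij: "i < r" "j < r" "k < r" "l < r"
  shows "basis_vector (h, i, j) \<otimes>\<^bsub>twisted_matrix_algebra G H \<alpha> r\<^esub> basis_vector (h', k, l) =
    (if j = k
     then \<alpha> h h' \<odot>\<^bsub>twisted_matrix_algebra G H \<alpha> r\<^esub> basis_vector (h \<otimes>\<^bsub>G\<^esub> h', i, l)
     else \<zero>\<^bsub>twisted_matrix_algebra G H \<alpha> r\<^esub>)"
proof -
  let ?I = "H \<times> ({..<r} \<times> {..<r})"
  let ?s = "tensor_constants (twisted_group_constants G \<alpha>) matrix_constants"
  have hh': "h \<otimes>\<^bsub>G\<^esub> h' \<in> H"
    using subgroup.m_closed[OF H(1) h] .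
  have "(\<Sum>a\<in>?I. \<Sum>b\<in>?I. ?s a b c * basis_vector (h, i, j) a * basis_vector (h', k, l) b) =
      ?s (h, i, j) (h', k, l) c" for c
  proof -
    have "(\<Sum>a\<in>?I. \<Sum>b\<in>?I. ?s a b c * basis_vector (h, i, j) a * basis_vector (h', k, l) b) =
        (\<Sum>a\<in>?I. if a = (h, i, j) then \<Sum>b\<in>?I. if b = (h', k, l) then ?s a b c else 0 else 0)"
      by (intro sum.cong refl) (auto simp: basis_vector_def intro!: sum.cong)
    also have "\<dots> = ?s (h, i, j) (h', k, l) c"
      using H h ij by (simp add: sum.delta)
    finally show ?thesis .
  qed
  then show ?thesis
    using hh' ij
    by (auto simp: twisted_matrix_algebra_def algebra_with_basis_def fun_eq_iff
        tensor_constants_def twisted_group_constants_def matrix_constants_def basis_vector_def)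
qed


section \<open>Presentations and their equivalence\<close>

definition two_cocycle ::
    "('g, 'm) monoid_scheme \<Rightarrow> 'g set \<Rightarrow> ('g \<Rightarrow> 'g \<Rightarrow> 'f::field) \<Rightarrow> bool"
  where "two_cocycle G H \<alpha> \<longleftrightarrow>
    (\<forall>h\<in>H. \<forall>k\<in>H. \<alpha> h k \<noteq> 0) \<and>
    (\<forall>h\<in>H. \<forall>k\<in>H. \<forall>l\<in>H.
      \<alpha> h k * \<alpha> (h \<otimes>\<^bsub>G\<^esub> k) l = \<alpha> k l * \<alpha> h (k \<otimes>\<^bsub>G\<^esub> l))"

definition cohomologous ::
    "('g, 'm) monoid_scheme \<Rightarrow> 'g set \<Rightarrow> ('g \<Rightarrow> 'g \<Rightarrow> 'f::field) \<Rightarrow> ('g \<Rightarrow> 'g \<Rightarrow> 'f) \<Rightarrow> bool"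
  where "cohomologous G H \<alpha> \<beta> \<longleftrightarrow>
    (\<exists>t. (\<forall>h\<in>H. t h \<noteq> 0) \<and>
      (\<forall>h\<in>H. \<forall>k\<in>H. \<beta> h k = t h * t k / t (h \<otimes>\<^bsub>G\<^esub> k) * \<alpha> h k))"

type_synonym ('g, 'f) presentation = "'g set \<times> ('g \<Rightarrow> 'g \<Rightarrow> 'f) \<times> 'g list"

fun is_presentation ::
    "('g, 'm) monoid_scheme \<Rightarrow> ('f::field, 'a) module \<Rightarrow> ('g \<Rightarrow> 'a set) \<Rightarrow>
      ('g, 'f) presentation \<Rightarrow> bool"
  where "is_presentation G A \<Gamma> (H, \<alpha>, ps) \<longleftrightarrow>
    subgroup H G \<and> finite H \<and> two_cocycle G H \<alpha> \<and>
    length ps \<ge> 1 \<and> set ps \<subseteq> carrier G \<and>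
    graded_isomorphic G A \<Gamma>
      (twisted_matrix_algebra G H \<alpha> (length ps)) (twisted_matrix_grading G H \<alpha> ps)"

inductive basic_move ::
    "('g, 'm) monoid_scheme \<Rightarrow> ('g, 'f) presentation \<Rightarrow> ('g, 'f) presentation \<Rightarrow> bool"
  for G :: "('g, 'm) monoid_scheme"
  where
    permute: "\<pi> permutes {..<length ps} \<Longrightarrow>
      basic_move G (H, \<alpha>, ps) (H, \<alpha>, permute_list \<pi> ps)"
  | translate: "\<lbrakk>i < length ps; h\<^sub>0 \<in> H\<rbrakk> \<Longrightarrow>
      basic_move G (H, \<alpha>, ps) (H, \<alpha>, ps[i := h\<^sub>0 \<otimes>\<^bsub>G\<^esub> ps ! i])"
  | conjugate: "g \<in> carrier G \<Longrightarrow>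
      basic_move G (H, \<alpha>, ps)
        ((\<lambda>h. g \<otimes>\<^bsub>G\<^esub> h \<otimes>\<^bsub>G\<^esub> inv\<^bsub>G\<^esub> g) ` H,
         (\<lambda>x y. \<alpha> (inv\<^bsub>G\<^esub> g \<otimes>\<^bsub>G\<^esub> x \<otimes>\<^bsub>G\<^esub> g) (inv\<^bsub>G\<^esub> g \<otimes>\<^bsub>G\<^esub> y \<otimes>\<^bsub>G\<^esub> g)),
         map (\<lambda>p. g \<otimes>\<^bsub>G\<^esub> p) ps)"

text \<open>
  The cocycle of a presentation is understood up to coboundaries, i.e. as its class in
  \<open>H\<^sup>2(H, F\<^sup>*)\<close>, so the sequence of basic moves is required to reach the target presentation up to
  the choice of the representing cocycle. The moves never rescale a cocycle: if cocycles were
  compared as functions, then for trivial \<open>H\<close> the presentations \<open>(H, 1, (1))\<close> and \<open>(H, c, (1))\<close>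
  of the algebra \<open>F\<close>, with a constant \<open>c \<noteq> 1\<close>, would be inequivalent.
  This also makes the values of \<open>\<alpha>\<close> outside \<open>H \<times> H\<close> irrelevant.
\<close>

fun equivalent_presentations ::
    "('g, 'm) monoid_scheme \<Rightarrow> ('g, 'f::field) presentation \<Rightarrow> ('g, 'f) presentation \<Rightarrow> bool"
  where "equivalent_presentations G P (K, \<beta>, qs) \<longleftrightarrow>
    (\<exists>\<alpha>'. (basic_move G)\<^sup>*\<^sup>* P (K, \<alpha>', qs) \<and> cohomologous G K \<alpha>' \<beta>)"

end

theory Submission
  imports Defs
begin

text \<open>
  Let \<open>\<theta>\<close> be a graded isomorphism between the two concrete algebras, and let \<open>e\<^sub>a\<close> be the diagonal
  idempotents of the first one. Each \<open>\<theta> e\<^sub>a\<close> is equivalent, through elements \<open>v\<^sub>a\<close>, \<open>w\<^sub>a\<close> of degree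
  \<open>\<one>\<close>, to a diagonal idempotent \<open>e\<^sub>\<sigma>\<^sub>a\<close> of the second algebra, because nonzero homogeneous elements
  of the corner \<open>\<theta> e\<^sub>a C \<theta> e\<^sub>a\<close> are invertible and its component of degree \<open>\<one>\<close> is the field. The maps
  \<open>x \<mapsto> w\<^sub>a (\<theta> x) v\<^sub>b\<close> preserve degrees between the corners, whose homogeneous components are at most
  one-dimensional. For \<open>a = b = 0\<close> they give the conjugating element \<open>g = q\<^sub>\<sigma>\<^sub>0 p\<^sub>0\<inverse>\<close> and the comparison
  of the cocycles; for \<open>a = 0\<close> and general \<open>b\<close> they show that \<open>g p\<^sub>b\<close> and \<open>q\<^sub>\<sigma>\<^sub>b\<close> lie in the same coset.
  A trace on the component of degree \<open>\<one>\<close>, one for every coset, is invariant under equivalence of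
  idempotents, so in characteristic zero every coset occurs with the same multiplicity among the
  \<open>g p\<^sub>a\<close> as among the \<open>q\<^sub>i\<close>.
\<close>

section \<open>The algebra of a presentation in coordinates\<close>

lemma sum_delta2:
  assumes "finite A" "finite B" "a \<in> A" "b \<in> B"
  shows "(\<Sum>x\<in>A. \<Sum>y\<in>B. if x = a then if y = b then c else 0 else 0) = c"
proof -
  have "(\<Sum>x\<in>A. \<Sum>y\<in>B. if x = a then if y = b then c else 0 else 0) =
      (\<Sum>x\<in>A. if x = a then c else 0)"
    using assms by (intro sum.cong refl) (auto simp: sum.delta)
  then show ?thesis
    using assms by (simp add: sum.delta)
qed

locale twisted_matrix = group G for G :: "('g, 'm) monoid_scheme" (structure) +
  fixes H :: "'g set" and \<alpha> :: "'g \<Rightarrow> 'g \<Rightarrow> 'f::field" and ps :: "'g list"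
  assumes subgroup: "subgroup H G" and finite: "finite H"
    and cocycle: "two_cocycle G H \<alpha>"
    and ps_carrier: "set ps \<subseteq> carrier G"
begin

abbreviation C :: "('f, 'g \<times> nat \<times> nat \<Rightarrow> 'f) module"
  where "C \<equiv> twisted_matrix_algebra G H \<alpha> (length ps)"

definition basis_degree :: "'g \<times> nat \<times> nat \<Rightarrow> 'g"
  where "basis_degree = (\<lambda>(h, i, j). inv (ps ! i) \<otimes> h \<otimes> ps ! j)"

text \<open>The grading by supports rather than by spans, which makes degrees readable from
  coefficients. \<open>twisted_matrix_grading_eq\<close> identifies it with the given
  grading.\<close>

definition component :: "'g \<Rightarrow> ('g \<times> nat \<times> nat \<Rightarrow> 'f) set"
  where "component d = {x \<in> carrier C. \<forall>b. x b \<noteq> 0 \<longrightarrow> basis_degree b = d}"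

lemma H_closed [simp, intro]:
  "\<one> \<in> H" "h \<in> H \<Longrightarrow> inv h \<in> H" "h \<in> H \<Longrightarrow> k \<in> H \<Longrightarrow> h \<otimes> k \<in> H"
  "h \<in> H \<Longrightarrow> h \<in> carrier G"
  using subgroup subgroup.one_closed subgroup.m_inv_closed subgroup.m_closed subgroup.mem_carrier
  by metis+

lemma ps_closed [simp, intro]: "i < length ps \<Longrightarrow> ps ! i \<in> carrier G"
  using ps_carrier nth_mem by blast

lemma inv_mult_cancel [simp]:
  "a \<in> carrier G \<Longrightarrow> b \<in> carrier G \<Longrightarrow> inv a \<otimes> (a \<otimes> b) = b"
  "a \<in> carrier G \<Longrightarrow> b \<in> carrier G \<Longrightarrow> a \<otimes> (inv a \<otimes> b) = b"
  by (simp_all add: m_assoc [symmetric])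

lemma cocycle_nonzero [simp]: "h \<in> H \<Longrightarrow> k \<in> H \<Longrightarrow> \<alpha> h k \<noteq> 0"
  using cocycle by (auto simp: two_cocycle_def)

lemma cocycle_eq:
  "h \<in> H \<Longrightarrow> k \<in> H \<Longrightarrow> l \<in> H \<Longrightarrow> \<alpha> h k * \<alpha> (h \<otimes> k) l = \<alpha> k l * \<alpha> h (k \<otimes> l)"
  using cocycle by (auto simp: two_cocycle_def)

text \<open>The cocycle identity at (\<open>\<one>\<close>, \<open>\<one>\<close>, \<open>h\<close>)
  and (\<open>h\<close>, \<open>\<one>\<close>, \<open>\<one>\<close>), with a nonzero factor
  cancelled. Cocycles are not normalised, so \<open>u_\<one>\<close> is
  \<open>\<alpha> \<one> \<one>\<close> times the identity, and this scalar recurs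
  throughout.\<close>

lemma cocycle_one: "h \<in> H \<Longrightarrow> \<alpha> \<one> h = \<alpha> \<one> \<one>" "h \<in> H \<Longrightarrow> \<alpha> h \<one> = \<alpha> \<one> \<one>"
  using cocycle_eq [of \<one> \<one> h] cocycle_eq [of h \<one> \<one>] by auto

lemma cocycle_inv: "h \<in> H \<Longrightarrow> \<alpha> h (inv h) = \<alpha> (inv h) h"
  using cocycle_eq [of h "inv h" h] by (simp add: cocycle_one [of h])

lemma basis_degree_closed:
  "h \<in> H \<Longrightarrow> i < length ps \<Longrightarrow> j < length ps \<Longrightarrow> basis_degree (h, i, j) \<in> carrier G"
  by (simp add: basis_degree_def)

lemma basis_degree_mult:
  "h \<in> H \<Longrightarrow> k \<in> H \<Longrightarrow> i < length ps \<Longrightarrow> j < length ps \<Longrightarrow> l < length ps \<Longrightarrow>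
    basis_degree (h, i, j) \<otimes> basis_degree (k, j, l) = basis_degree (h \<otimes> k, i, l)"
  by (simp add: basis_degree_def m_assoc)

lemma basis_degree_one_diag: "i < length ps \<Longrightarrow> basis_degree (\<one>, i, i) = \<one>"
  by (simp add: basis_degree_def)

text \<open>For fixed matrix indices the degree determines the group part. This is what makes the
  components of a corner at most one-dimensional.\<close>

lemma basis_degree_eq_iff:
  assumes "h \<in> H" "k \<in> H" "i < length ps" "j < length ps"
  shows "basis_degree (h, i, j) = basis_degree (k, i, j) \<longleftrightarrow> h = k"
  using assms by (simp add: basis_degree_def)

section \<open>Coefficients of elements and of products\<close>

lemma carrier_iff:
  "x \<in> carrier C \<longleftrightarrow> (\<forall>h i j. x (h, i, j) \<noteq> 0 \<longrightarrow> h \<in> H \<and> i < length ps \<and> j < length ps)"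
  unfolding twisted_matrix_algebra_def algebra_with_basis_def by auto

lemma component_iff:
  "x \<in> component d \<longleftrightarrow> (\<forall>h i j. x (h, i, j) \<noteq> 0 \<longrightarrow>
    h \<in> H \<and> i < length ps \<and> j < length ps \<and> basis_degree (h, i, j) = d)"
  unfolding component_def carrier_iff by auto

lemma component_carrier: "x \<in> component d \<Longrightarrow> x \<in> carrier C"
  by (simp add: component_def)

lemma zero_apply: "\<zero>\<^bsub>C\<^esub> b = 0"
  and add_apply: "(x \<oplus>\<^bsub>C\<^esub> y) b = x b + y b"
  and smult_apply: "(c \<odot>\<^bsub>C\<^esub> x) b = c * x b"
  unfolding twisted_matrix_algebra_def algebra_with_basis_def by simp_all

text \<open>The structure constants vanish unless the inner matrix indices agree and the group parts
  multiply to \<open>k\<close>, so only the left group part and the inner index remain free.\<close>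

lemma mult_apply:
  assumes k: "k \<in> H" "i < length ps" "l < length ps"
  shows "(x \<otimes>\<^bsub>C\<^esub> y) (k, i, l) =
    (\<Sum>h\<in>H. \<Sum>j<length ps. \<alpha> h (inv h \<otimes> k) * x (h, i, j) * y (inv h \<otimes> k, j, l))"
proof -
  let ?r = "length ps"
  let ?I = "H \<times> ({..<?r} \<times> {..<?r})"
  let ?s = "tensor_constants (twisted_group_constants G \<alpha>) matrix_constants"
  have inner: "(\<Sum>q\<in>?I. ?s (h, a, j) q (k, i, l) * x (h, a, j) * y q) =
      (if a = i then \<alpha> h (inv h \<otimes> k) * x (h, i, j) * y (inv h \<otimes> k, j, l) else 0)"
    if "h \<in> H" "a < ?r" "j < ?r" for h a j
  proof -
    have *: "k = h \<otimes> h' \<longleftrightarrow> h' = inv h \<otimes> k" if "h' \<in> H" for h'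
      using that k \<open>h \<in> H\<close> by auto
    have "?s (h, a, j) q (k, i, l) * x (h, a, j) * y q = (if q = (inv h \<otimes> k, j, l)
        then if a = i then \<alpha> h (inv h \<otimes> k) * x (h, i, j) * y (inv h \<otimes> k, j, l) else 0 else 0)"
      if q_in: "q \<in> ?I" for q
    proof -
      obtain h' c d where q: "q = (h', c, d)" and h': "h' \<in> H"
        using q_in by blast
      show ?thesis
        unfolding q tensor_constants_def twisted_group_constants_def matrix_constants_def
        by (simp add: * [OF h'])
    qed
    then have "(\<Sum>q\<in>?I. ?s (h, a, j) q (k, i, l) * x (h, a, j) * y q) =
        (\<Sum>q\<in>?I. if q = (inv h \<otimes> k, j, l)
          then if a = i then \<alpha> h (inv h \<otimes> k) * x (h, i, j) * y (inv h \<otimes> k, j, l) else 0 else 0)"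
      by (rule sum.cong [OF refl])
    also have "\<dots> = (if a = i then \<alpha> h (inv h \<otimes> k) * x (h, i, j) * y (inv h \<otimes> k, j, l) else 0)"
      using that k finite by (simp add: sum.delta)
    finally show ?thesis .
  qed
  have "(x \<otimes>\<^bsub>C\<^esub> y) (k, i, l) = (\<Sum>p\<in>?I. \<Sum>q\<in>?I. ?s p q (k, i, l) * x p * y q)"
    using k by (simp add: twisted_matrix_algebra_def algebra_with_basis_def)
  also have "\<dots> = (\<Sum>h\<in>H. \<Sum>a<?r. \<Sum>j<?r. \<Sum>q\<in>?I. ?s (h, a, j) q (k, i, l) * x (h, a, j) * y q)"
    by (simp only: sum.cartesian_product')
  also have "\<dots> = (\<Sum>h\<in>H. \<Sum>a<?r. \<Sum>j<?r.
      if a = i then \<alpha> h (inv h \<otimes> k) * x (h, i, j) * y (inv h \<otimes> k, j, l) else 0)"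
    by (intro sum.cong refl inner) auto
  also have "\<dots> = (\<Sum>h\<in>H. \<Sum>a<?r. if a = i
      then \<Sum>j<?r. \<alpha> h (inv h \<otimes> k) * x (h, i, j) * y (inv h \<otimes> k, j, l) else 0)"
    by (intro sum.cong refl) auto
  finally show ?thesis
    using k by (simp add: sum.delta)
qed

lemma mult_apply_outside:
  "\<not> (k \<in> H \<and> i < length ps \<and> l < length ps) \<Longrightarrow> (x \<otimes>\<^bsub>C\<^esub> y) (k, i, l) = 0"
  by (auto simp: twisted_matrix_algebra_def algebra_with_basis_def)

lemma C_closed [simp]:
  "x \<otimes>\<^bsub>C\<^esub> y \<in> carrier C" "\<zero>\<^bsub>C\<^esub> \<in> carrier C"
  "x \<in> carrier C \<Longrightarrow> y \<in> carrier C \<Longrightarrow> x \<oplus>\<^bsub>C\<^esub> y \<in> carrier C"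
  "x \<in> carrier C \<Longrightarrow> c \<odot>\<^bsub>C\<^esub> x \<in> carrier C"
  by (auto simp: twisted_matrix_algebra_def algebra_with_basis_def)

lemma C_eqI:
  assumes "x \<in> carrier C" "y \<in> carrier C"
    and "\<And>k i j. k \<in> H \<Longrightarrow> i < length ps \<Longrightarrow> j < length ps \<Longrightarrow> x (k, i, j) = y (k, i, j)"
  shows "x = y"
proof
  fix b :: "'g \<times> nat \<times> nat"
  obtain k i j where "b = (k, i, j)"
    using prod_cases3 by blast
  then show "x b = y b"
    using assms unfolding carrier_iff by metis
qed

lemma smult_mult [simp]:
  "(c \<odot>\<^bsub>C\<^esub> x) \<otimes>\<^bsub>C\<^esub> y = c \<odot>\<^bsub>C\<^esub> (x \<otimes>\<^bsub>C\<^esub> y)"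
  "x \<otimes>\<^bsub>C\<^esub> (c \<odot>\<^bsub>C\<^esub> y) = c \<odot>\<^bsub>C\<^esub> (x \<otimes>\<^bsub>C\<^esub> y)"
  by (rule C_eqI; simp add: mult_apply smult_apply sum_distrib_left mult_ac)+

lemma zero_mult [simp]: "\<zero>\<^bsub>C\<^esub> \<otimes>\<^bsub>C\<^esub> x = \<zero>\<^bsub>C\<^esub>" "x \<otimes>\<^bsub>C\<^esub> \<zero>\<^bsub>C\<^esub> = \<zero>\<^bsub>C\<^esub>"
  by (rule C_eqI; simp add: mult_apply zero_apply)+

lemma smult_simps [simp]:
  "c \<odot>\<^bsub>C\<^esub> (d \<odot>\<^bsub>C\<^esub> x) = (c * d) \<odot>\<^bsub>C\<^esub> x" "1 \<odot>\<^bsub>C\<^esub> x = x" "0 \<odot>\<^bsub>C\<^esub> x = \<zero>\<^bsub>C\<^esub>"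
  "c \<odot>\<^bsub>C\<^esub> \<zero>\<^bsub>C\<^esub> = \<zero>\<^bsub>C\<^esub>"
  by (rule ext; simp add: smult_apply zero_apply)+

text \<open>After the substitution \<open>h = h' \<otimes> m\<close> the summands of the two
  bracketings differ only in their cocycle factors, and these agree by the cocycle identity.\<close>

lemma mult_assoc: "(x \<otimes>\<^bsub>C\<^esub> y) \<otimes>\<^bsub>C\<^esub> z = x \<otimes>\<^bsub>C\<^esub> (y \<otimes>\<^bsub>C\<^esub> z)"
proof (rule C_eqI)
  fix k i l assume k: "k \<in> H" "i < length ps" "l < length ps"
  let ?r = "length ps"
  let ?f = "\<lambda>h' j' h j. \<alpha> h (inv h \<otimes> k) * \<alpha> h' (inv h' \<otimes> h) *
    x (h', i, j') * y (inv h' \<otimes> h, j', j) * z (inv h \<otimes> k, j, l)"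
  have *: "(\<Sum>h\<in>H. ?f h' j' h j) = (\<Sum>m\<in>H. ?f h' j' (h' \<otimes> m) j)" if "h' \<in> H" for h' j' j
    by (rule sum.reindex_bij_witness [of _ "\<lambda>m. h' \<otimes> m" "\<lambda>h. inv h' \<otimes> h"]) (use that in auto)
  have **: "?f h' j' (h' \<otimes> m) j = \<alpha> h' (inv h' \<otimes> k) * x (h', i, j') *
      (\<alpha> m (inv m \<otimes> (inv h' \<otimes> k)) * y (m, j', j) * z (inv m \<otimes> (inv h' \<otimes> k), j, l))"
    if "h' \<in> H" "m \<in> H" for h' m j' j
  proof -
    define n where "n = inv m \<otimes> (inv h' \<otimes> k)"
    have n: "n \<in> H" "inv (h' \<otimes> m) \<otimes> k = n" "inv h' \<otimes> k = m \<otimes> n" "inv h' \<otimes> (h' \<otimes> m) = m"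
      using that k by (auto simp: n_def inv_mult_group m_assoc)
    show ?thesis
      unfolding n_def [symmetric] n using that n(1) cocycle_eq [OF that n(1)] by (simp add: mult_ac)
  qed
  have "((x \<otimes>\<^bsub>C\<^esub> y) \<otimes>\<^bsub>C\<^esub> z) (k, i, l) =
      (\<Sum>h\<in>H. \<Sum>j<?r. \<Sum>h'\<in>H. \<Sum>j'<?r. ?f h' j' h j)"
    using k by (simp add: mult_apply sum_distrib_left sum_distrib_right mult_ac)
  also have "\<dots> = (\<Sum>h\<in>H. \<Sum>h'\<in>H. \<Sum>j<?r. \<Sum>j'<?r. ?f h' j' h j)"
    by (intro sum.cong refl sum.swap)
  also have "\<dots> = (\<Sum>h'\<in>H. \<Sum>h\<in>H. \<Sum>j'<?r. \<Sum>j<?r. ?f h' j' h j)"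
    by (subst sum.swap) (intro sum.cong refl sum.swap)
  also have "\<dots> = (\<Sum>h'\<in>H. \<Sum>j'<?r. \<Sum>j<?r. \<Sum>h\<in>H. ?f h' j' h j)"
    by (subst (2) sum.swap, subst (3) sum.swap) simp
  also have "\<dots> = (\<Sum>h'\<in>H. \<Sum>j'<?r. \<Sum>j<?r. \<Sum>m\<in>H. ?f h' j' (h' \<otimes> m) j)"
    by (intro sum.cong refl *)
  also have "\<dots> = (\<Sum>h'\<in>H. \<Sum>j'<?r. \<Sum>m\<in>H. \<Sum>j<?r. ?f h' j' (h' \<otimes> m) j)"
    by (subst (3) sum.swap) simp
  also have "\<dots> = (\<Sum>h'\<in>H. \<Sum>j'<?r. \<Sum>m\<in>H. \<Sum>j<?r. \<alpha> h' (inv h' \<otimes> k) * x (h', i, j') *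
      (\<alpha> m (inv m \<otimes> (inv h' \<otimes> k)) * y (m, j', j) * z (inv m \<otimes> (inv h' \<otimes> k), j, l)))"
    by (intro sum.cong refl **)
  also have "\<dots> = (x \<otimes>\<^bsub>C\<^esub> (y \<otimes>\<^bsub>C\<^esub> z)) (k, i, l)"
    using k by (simp add: mult_apply sum_distrib_left)
  finally show "((x \<otimes>\<^bsub>C\<^esub> y) \<otimes>\<^bsub>C\<^esub> z) (k, i, l) = (x \<otimes>\<^bsub>C\<^esub> (y \<otimes>\<^bsub>C\<^esub> z)) (k, i, l)" .
qed simp_all

section \<open>Diagonal idempotents and homogeneous elements of corners\<close>

definition diag :: "nat \<Rightarrow> 'g \<times> nat \<times> nat \<Rightarrow> 'f"
  where "diag i = (1 / \<alpha> \<one> \<one>) \<odot>\<^bsub>C\<^esub> basis_vector (\<one>, i, i)"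

lemma basis_vector_component:
  "h \<in> H \<Longrightarrow> i < length ps \<Longrightarrow> j < length ps \<Longrightarrow>
    basis_vector (h, i, j) \<in> component (basis_degree (h, i, j))"
  by (auto simp: component_iff basis_vector_def)

lemma basis_vector_nonzero [simp]: "basis_vector b \<noteq> \<zero>\<^bsub>C\<^esub>"
proof
  assume "basis_vector b = \<zero>\<^bsub>C\<^esub>"
  then have "basis_vector b b = (0 :: 'f)"
    by (simp add: zero_apply)
  then show False
    by (simp add: basis_vector_def)
qed

lemma component_smult: "x \<in> component d \<Longrightarrow> c \<odot>\<^bsub>C\<^esub> x \<in> component d"
  by (auto simp: component_iff smult_apply)

lemma component_mult:
  assumes x: "x \<in> component d" and y: "y \<in> component d'"
  shows "x \<otimes>\<^bsub>C\<^esub> y \<in> component (d \<otimes> d')"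
  unfolding component_iff
proof (intro allI impI)
  fix k i l
  assume nz: "(x \<otimes>\<^bsub>C\<^esub> y) (k, i, l) \<noteq> 0"
  then have k: "k \<in> H" "i < length ps" "l < length ps"
    using mult_apply_outside by blast+
  obtain h where h: "h \<in> H"
    and "(\<Sum>j<length ps. \<alpha> h (inv h \<otimes> k) * x (h, i, j) * y (inv h \<otimes> k, j, l)) \<noteq> 0"
    using nz unfolding mult_apply [OF k] by (rule sum.not_neutral_contains_not_neutral)
  then obtain j where "\<alpha> h (inv h \<otimes> k) * x (h, i, j) * y (inv h \<otimes> k, j, l) \<noteq> 0"
    using sum.not_neutral_contains_not_neutral by blast
  then have "x (h, i, j) \<noteq> 0" "y (inv h \<otimes> k, j, l) \<noteq> 0"
    by auto
  then have j: "j < length ps" and "d = basis_degree (h, i, j)" "d' = basis_degree (inv h \<otimes> k, j, l)"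
    using x y unfolding component_iff by metis+
  then show "k \<in> H \<and> i < length ps \<and> l < length ps \<and> basis_degree (k, i, l) = d \<otimes> d'"
    using basis_degree_mult [of h "inv h \<otimes> k" i j l] h k by auto
qed

lemma unit_mult_apply:
  assumes x: "x \<in> carrier C" and i: "i < length ps" "j < length ps"
  shows "(basis_vector (\<one>, i, j) \<otimes>\<^bsub>C\<^esub> x) (k, a, b) = (if a = i then \<alpha> \<one> \<one> * x (k, j, b) else 0)"
proof (cases "k \<in> H \<and> a < length ps \<and> b < length ps")
  case True
  have "\<alpha> h (inv h \<otimes> k) * basis_vector (\<one>, i, j) (h, a, c) * x (inv h \<otimes> k, c, b) =
      (if h = \<one> then if c = j then if a = i then \<alpha> \<one> \<one> * x (k, j, b) else 0 else 0 else 0)" for h c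
    using True by (auto simp: basis_vector_def cocycle_one [of k])
  then show ?thesis
    using True i finite by (simp add: mult_apply sum_delta2 del: if_split)
next
  case False
  then have "(basis_vector (\<one>, i, j) \<otimes>\<^bsub>C\<^esub> x) (k, a, b) = 0" "a = i \<Longrightarrow> x (k, j, b) = 0"
    using x i mult_apply_outside unfolding carrier_iff by blast+
  then show ?thesis
    by simp
qed

lemma mult_unit_apply:
  assumes x: "x \<in> carrier C" and i: "i < length ps" "j < length ps"
  shows "(x \<otimes>\<^bsub>C\<^esub> basis_vector (\<one>, i, j)) (k, a, b) = (if b = j then \<alpha> \<one> \<one> * x (k, a, i) else 0)"
proof (cases "k \<in> H \<and> a < length ps \<and> b < length ps")
  case True
  have "\<alpha> h (inv h \<otimes> k) * x (h, a, c) * basis_vector (\<one>, i, j) (inv h \<otimes> k, c, b) =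
      (if h = k then if c = i then if b = j then \<alpha> \<one> \<one> * x (k, a, i) else 0 else 0 else 0)"
    if "h \<in> H" for h c
  proof -
    have "inv h \<otimes> k = \<one> \<longleftrightarrow> h = k"
      using that True by (metis H_closed(4) inv_mult_cancel(2) l_inv r_one)
    then show ?thesis
      using True by (auto simp: basis_vector_def cocycle_one [of k])
  qed
  then show ?thesis
    using True i finite by (simp add: mult_apply sum_delta2 del: if_split)
next
  case False
  then have "(x \<otimes>\<^bsub>C\<^esub> basis_vector (\<one>, i, j)) (k, a, b) = 0" "b = j \<Longrightarrow> x (k, a, i) = 0"
    using x i mult_apply_outside unfolding carrier_iff by blast+
  then show ?thesis
    by simp
qed

lemma mult_basis_vector:
  "h \<in> H \<Longrightarrow> k \<in> H \<Longrightarrow> i < length ps \<Longrightarrow> j < length ps \<Longrightarrow> l < length ps \<Longrightarrow>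
    basis_vector (h, i, j) \<otimes>\<^bsub>C\<^esub> basis_vector (k, j, l) =
      \<alpha> h k \<odot>\<^bsub>C\<^esub> basis_vector (h \<otimes> k, i, l)"
  by (simp add: basis_vector_mult [OF is_group subgroup finite])

lemma diag_apply: "diag i b = (if b = (\<one>, i, i) then 1 / \<alpha> \<one> \<one> else 0)"
  by (simp add: diag_def smult_apply basis_vector_def)

lemma diag_component: "i < length ps \<Longrightarrow> diag i \<in> component \<one>"
  unfolding diag_def using basis_vector_component [of \<one> i i]
  by (auto intro!: component_smult simp: basis_degree_one_diag)

lemma diag_mult_apply:
  "x \<in> carrier C \<Longrightarrow> i < length ps \<Longrightarrow> (diag i \<otimes>\<^bsub>C\<^esub> x) (k, a, b) = (if a = i then x (k, a, b) else 0)"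
  by (simp add: diag_def smult_apply unit_mult_apply)

lemma mult_diag_apply:
  "x \<in> carrier C \<Longrightarrow> i < length ps \<Longrightarrow> (x \<otimes>\<^bsub>C\<^esub> diag i) (k, a, b) = (if b = i then x (k, a, b) else 0)"
  by (simp add: diag_def smult_apply mult_unit_apply)

lemma diag_mult_basis_vector [simp]:
  assumes "h \<in> H" "i < length ps" "j < length ps"
  shows "diag i \<otimes>\<^bsub>C\<^esub> basis_vector (h, i, j) = basis_vector (h, i, j)"
    and "basis_vector (h, i, j) \<otimes>\<^bsub>C\<^esub> diag j = basis_vector (h, i, j)"
proof -
  have "basis_vector (h, i, j) \<in> carrier C"
    using assms basis_vector_component component_carrier by blast
  then show "diag i \<otimes>\<^bsub>C\<^esub> basis_vector (h, i, j) = basis_vector (h, i, j)"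
    and "basis_vector (h, i, j) \<otimes>\<^bsub>C\<^esub> diag j = basis_vector (h, i, j)"
    using assms by (intro C_eqI; simp add: diag_mult_apply mult_diag_apply basis_vector_def)+
qed

text \<open>The scalar in \<open>diag\<close> is chosen for this:
  \<open>basis_vector (\<one>, i, i)\<close> squares to \<open>\<alpha> \<one> \<one>\<close> times
  itself.\<close>

lemma diag_idem [simp]: "i < length ps \<Longrightarrow> diag i \<otimes>\<^bsub>C\<^esub> diag i = diag i"
  using diag_mult_basis_vector(1) [of \<one> i i] by (simp add: diag_def [of i] del: diag_mult_basis_vector)

lemma diag_nonzero: "i < length ps \<Longrightarrow> diag i \<noteq> \<zero>\<^bsub>C\<^esub>"
  using diag_apply [of i "(\<one>, i, i)"] by (auto simp: zero_apply)

lemma C_nonzero_obtain: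
  assumes "x \<in> carrier C" "x \<noteq> \<zero>\<^bsub>C\<^esub>"
  obtains h i j where "x (h, i, j) \<noteq> 0" "h \<in> H" "i < length ps" "j < length ps"
  using assms C_eqI [of x "\<zero>\<^bsub>C\<^esub>"] by (auto simp: zero_apply)

text \<open>A graded form of primeness. The matrix unit \<open>z\<close> links the column of a
  nonzero coefficient of \<open>x\<close> to the row of a nonzero coefficient of
  \<open>y\<close>.\<close>

lemma mult_nonzero:
  assumes x: "x \<in> component d" "x \<noteq> \<zero>\<^bsub>C\<^esub>" and y: "y \<in> carrier C" "y \<noteq> \<zero>\<^bsub>C\<^esub>"
  obtains z d' where "d' \<in> carrier G" "z \<in> component d'" "x \<otimes>\<^bsub>C\<^esub> z \<otimes>\<^bsub>C\<^esub> y \<noteq> \<zero>\<^bsub>C\<^esub>"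
proof -
  obtain h i j where h: "x (h, i, j) \<noteq> 0" "h \<in> H" "i < length ps" "j < length ps"
    using x C_nonzero_obtain component_carrier by blast
  obtain k l m where k: "y (k, l, m) \<noteq> 0" "k \<in> H" "l < length ps" "m < length ps"
    using y C_nonzero_obtain by blast
  let ?z = "basis_vector (\<one>, j, l) :: 'g \<times> nat \<times> nat \<Rightarrow> 'f"
  \<comment> \<open>homogeneity of \<open>x\<close> leaves only one summand, so that nothing cancels\<close>
  have x_eq: "x (h', i, j) = 0" if "h' \<noteq> h" for h'
    using x h that basis_degree_eq_iff unfolding component_iff by metis
  have "\<alpha> h' (inv h' \<otimes> (h \<otimes> k)) * (x \<otimes>\<^bsub>C\<^esub> ?z) (h', i, c) * y (inv h' \<otimes> (h \<otimes> k), c, m) =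
      (if h' = h then if c = l then \<alpha> h k * (\<alpha> \<one> \<one> * x (h, i, j)) * y (k, l, m) else 0 else 0)"
    for h' c
    using h k x x_eq by (simp add: mult_unit_apply component_carrier)
  then have "(x \<otimes>\<^bsub>C\<^esub> ?z \<otimes>\<^bsub>C\<^esub> y) (h \<otimes> k, i, m) = \<alpha> h k * (\<alpha> \<one> \<one> * x (h, i, j)) * y (k, l, m)"
    using h k finite by (simp add: mult_apply [of "h \<otimes> k"] sum_delta2)
  also have "\<dots> \<noteq> 0"
    using h k by simp
  finally have "x \<otimes>\<^bsub>C\<^esub> ?z \<otimes>\<^bsub>C\<^esub> y \<noteq> \<zero>\<^bsub>C\<^esub>"
    by (auto simp: zero_apply)
  then show thesis
    using that basis_vector_component [of \<one> j l] basis_degree_closed [of \<one> j l] h k by blast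
qed

text \<open>The corner conditions confine the support to row \<open>i\<close> and column
  \<open>j\<close>, and there the degree leaves only one group part.\<close>

lemma corner_component:
  assumes x: "x \<in> component d" "x \<noteq> \<zero>\<^bsub>C\<^esub>" and i: "i < length ps" "j < length ps"
    and corner: "diag i \<otimes>\<^bsub>C\<^esub> x = x" "x \<otimes>\<^bsub>C\<^esub> diag j = x"
  obtains h c where "h \<in> H" "c \<noteq> 0" "d = basis_degree (h, i, j)" "x = c \<odot>\<^bsub>C\<^esub> basis_vector (h, i, j)"
proof -
  have ij: "a = i \<and> b = j" if "x (k, a, b) \<noteq> 0" for k a b
    using that x i diag_mult_apply [of x i k a b] mult_diag_apply [of x j k a b] component_carrier
    unfolding corner by (auto split: if_splits)
  obtain h where h: "x (h, i, j) \<noteq> 0" "h \<in> H"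
    using x C_nonzero_obtain component_carrier ij by metis
  have d: "d = basis_degree (h, i, j)"
    using x h by (auto simp: component_iff)
  have "x (k, a, b) = 0" if "(k, a, b) \<noteq> (h, i, j)" for k a b
    using x h d i that ij [of k a b] basis_degree_eq_iff [of k h i j] unfolding component_iff by metis
  then have "x b = (x (h, i, j) \<odot>\<^bsub>C\<^esub> basis_vector (h, i, j)) b" for b
    by (cases b) (auto simp: smult_apply basis_vector_def)
  then show thesis
    using that h d by blast
qed

section \<open>Traces on the degree-one component, one for each coset of \<open>H\<close>\<close>

definition coset_trace :: "'g set \<Rightarrow> ('g \<times> nat \<times> nat \<Rightarrow> 'f) \<Rightarrow> 'f"
  where "coset_trace c x = (\<Sum>i | i < length ps \<and> H #> ps ! i = c. x (\<one>, i, i))"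

lemma coset_eq: "h \<in> H \<Longrightarrow> p \<in> carrier G \<Longrightarrow> H #> (h \<otimes> p) = H #> p"
  using subgroup by (metis coset_join2 coset_mult_assoc H_closed(4) subgroup.subset)

text \<open>Degree \<open>\<one>\<close> means \<open>ps ! i = h \<otimes> ps ! j\<close>. Hence the
  degree-one component is block diagonal, with one block for each coset that occurs.\<close>

lemma basis_degree_one_coset:
  assumes "h \<in> H" "i < length ps" "j < length ps" "basis_degree (h, i, j) = \<one>"
  shows "H #> ps ! i = H #> ps ! j"
proof -
  have "ps ! i = ps ! i \<otimes> basis_degree (h, i, j)"
    using assms by simp
  also have "\<dots> = h \<otimes> ps ! j"
    using assms(1-3) by (simp add: basis_degree_def m_assoc)
  finally show ?thesis
    using assms coset_eq by simp
qed

text \<open>On the degree-one component \<open>coset_trace c\<close> is the matrix trace of the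
  block of \<open>c\<close>, divided by \<open>\<alpha> \<one> \<one>\<close>. Inner indices
  \<open>j\<close> from other cosets contribute nothing because of the degree of \<open>x\<close>;
  afterwards \<open>i\<close> and \<open>j\<close> range over the same set, as the exchange of
  factors requires.\<close>

lemma coset_trace_mult:
  assumes x: "x \<in> component \<one>"
  shows "coset_trace c (x \<otimes>\<^bsub>C\<^esub> y) =
    (\<Sum>i | i < length ps \<and> H #> ps ! i = c. \<Sum>j | j < length ps \<and> H #> ps ! j = c.
      \<Sum>h\<in>H. \<alpha> h (inv h) * x (h, i, j) * y (inv h, j, i))"
  unfolding coset_trace_def
proof (intro sum.cong refl, clarify)
  fix i assume i: "i < length ps" "c = H #> ps ! i"
  have "(x \<otimes>\<^bsub>C\<^esub> y) (\<one>, i, i) =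
      (\<Sum>h\<in>H. \<Sum>j<length ps. \<alpha> h (inv h) * x (h, i, j) * y (inv h, j, i))"
    using i by (simp add: mult_apply)
  also have "\<dots> = (\<Sum>j<length ps. \<Sum>h\<in>H. \<alpha> h (inv h) * x (h, i, j) * y (inv h, j, i))"
    by (rule sum.swap)
  also have "\<dots> = (\<Sum>j | j < length ps \<and> H #> ps ! j = H #> ps ! i.
      \<Sum>h\<in>H. \<alpha> h (inv h) * x (h, i, j) * y (inv h, j, i))"
  proof (rule sum.mono_neutral_right)
    have "x (h, i, j) = 0" if "H #> ps ! j \<noteq> H #> ps ! i" for h j
      using x i that basis_degree_one_coset unfolding component_iff by metis
    then show "\<forall>j\<in>{..<length ps} - {j. j < length ps \<and> H #> ps ! j = H #> ps ! i}.
        (\<Sum>h\<in>H. \<alpha> h (inv h) * x (h, i, j) * y (inv h, j, i)) = 0"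
      by (auto intro!: sum.neutral)
  qed auto
  finally show "(x \<otimes>\<^bsub>C\<^esub> y) (\<one>, i, i) = (\<Sum>j | j < length ps \<and> H #> ps ! j = H #> ps ! i.
      \<Sum>h\<in>H. \<alpha> h (inv h) * x (h, i, j) * y (inv h, j, i))" .
qed

text \<open>Replacing \<open>h\<close> by \<open>inv h\<close> exchanges the roles of
  \<open>x\<close> and \<open>y\<close>, the scalar is unchanged by \<open>cocycle_inv\<close>, and
  the two block indices can be swapped.\<close>

lemma coset_trace_commute:
  assumes x: "x \<in> component \<one>" and y: "y \<in> component \<one>"
  shows "coset_trace c (x \<otimes>\<^bsub>C\<^esub> y) = coset_trace c (y \<otimes>\<^bsub>C\<^esub> x)"
proof -
  have *: "(\<Sum>h\<in>H. \<alpha> h (inv h) * x (h, i, j) * y (inv h, j, i)) =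
      (\<Sum>h\<in>H. \<alpha> h (inv h) * y (h, j, i) * x (inv h, i, j))" for i j
    by (rule sum.reindex_bij_witness [of _ "\<lambda>h. inv h" "\<lambda>h. inv h"]) (auto simp: cocycle_inv)
  show ?thesis
    unfolding coset_trace_mult [OF x] coset_trace_mult [OF y] *
    by (rule sum.swap)
qed

lemma coset_trace_diag:
  "i < length ps \<Longrightarrow> coset_trace c (diag i) = (if H #> ps ! i = c then 1 / \<alpha> \<one> \<one> else 0)"
  by (simp add: coset_trace_def diag_apply sum.delta)

section \<open>Finite sums, and the grading as a span of basis vectors\<close>

lemma abelian_monoid_C: "abelian_monoid C"
  by (rule abelian_monoidI; simp add: fun_eq_iff add_apply zero_apply)

lemma finsum_apply:
  assumes "finite T" "f \<in> T \<rightarrow> carrier C"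
  shows "finsum C f T b = (\<Sum>t\<in>T. f t b)"
  using assms
proof (induction rule: finite_induct)
  case empty
  then show ?case
    by (simp add: abelian_monoid.finsum_empty [OF abelian_monoid_C] zero_apply)
next
  case (insert t T)
  then show ?case
    using abelian_monoid.finsum_insert [OF abelian_monoid_C, of T t f]
    by (simp add: add_apply Pi_iff)
qed

lemma lin_span_component:
  assumes S: "S \<subseteq> component d" and x: "x \<in> lin_span C S"
  shows "x \<in> component d"
proof -
  obtain c T where T: "finite T" "T \<subseteq> S" "x = finsum C (\<lambda>s. c s \<odot>\<^bsub>C\<^esub> s) T"
    using x unfolding lin_span_def by blast
  have *: "c s \<odot>\<^bsub>C\<^esub> s \<in> component d" if "s \<in> T" for s
    using T that S component_smult by blast
  then have x: "x b = (\<Sum>s\<in>T. (c s \<odot>\<^bsub>C\<^esub> s) b)" for b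
    unfolding T(3) using T component_carrier by (intro finsum_apply) blast+
  show ?thesis
    unfolding component_iff
  proof (intro allI impI)
    fix h i j assume "x (h, i, j) \<noteq> 0"
    then obtain s where "s \<in> T" "(c s \<odot>\<^bsub>C\<^esub> s) (h, i, j) \<noteq> 0"
      unfolding x using sum.not_neutral_contains_not_neutral by blast
    then show "h \<in> H \<and> i < length ps \<and> j < length ps \<and> basis_degree (h, i, j) = d"
      using * unfolding component_iff by blast
  qed
qed

text \<open>An element supported on indices of degree \<open>d\<close> is the combination of the
  corresponding basis vectors weighted by its own coefficients.\<close>

lemma twisted_matrix_grading_eq: "twisted_matrix_grading G H \<alpha> ps d = component d"
proof -
  let ?B = "{b \<in> H \<times> {..<length ps} \<times> {..<length ps}. basis_degree b = d}"
  have B: "{basis_vector (h, i, j) | h i j. h \<in> H \<and> i < length ps \<and> j < length ps \<and>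
      d = inv (ps ! i) \<otimes> h \<otimes> ps ! j} = basis_vector ` ?B"
    by (auto simp: basis_degree_def)
  have inj: "inj (basis_vector :: 'g \<times> nat \<times> nat \<Rightarrow> _ \<Rightarrow> 'f)"
    by (auto simp: inj_def basis_vector_def fun_eq_iff split: if_splits)
  have fin: "finite ?B"
    using finite by simp
  have B_component: "basis_vector b \<in> component d" if "b \<in> ?B" for b
    using that basis_vector_component by auto
  have "basis_vector ` ?B \<subseteq> component d"
    using B_component by blast
  note lin_span_component [OF this]
  moreover have "x \<in> lin_span C (basis_vector ` ?B)" if x: "x \<in> component d" for x
  proof -
    \<comment> \<open>Weights in \<open>lin_span\<close> are indexed by the vectors themselves, so
      the index of a basis vector has to be recovered by inverting
      \<open>basis_vector\<close>.\<close>
    let ?c = "\<lambda>s :: 'g \<times> nat \<times> nat \<Rightarrow> 'f. x (inv_into UNIV basis_vector s)"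
    have coeff: "(?c (basis_vector b') \<odot>\<^bsub>C\<^esub> basis_vector b') b = (if b' = b then x b else 0)" for b b'
      by (simp add: smult_apply inv_f_f [OF inj]) (simp add: basis_vector_def)
    have "finsum C (\<lambda>s. ?c s \<odot>\<^bsub>C\<^esub> s) (basis_vector ` ?B) b = x b" for b
    proof -
      have "finsum C (\<lambda>s. ?c s \<odot>\<^bsub>C\<^esub> s) (basis_vector ` ?B) b =
          (\<Sum>s\<in>basis_vector ` ?B. (?c s \<odot>\<^bsub>C\<^esub> s) b)"
        using fin B_component component_smult component_carrier by (intro finsum_apply) blast+
      also have "\<dots> = (\<Sum>b'\<in>?B. if b' = b then x b else 0)"
        by (subst sum.reindex [OF inj_on_subset [OF inj subset_UNIV]])
          (auto intro!: sum.cong simp: coeff)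
      also have "\<dots> = x b"
        using fin x by (cases b) (auto simp: sum.delta component_iff)
      finally show ?thesis .
    qed
    then show ?thesis
      using fin unfolding lin_span_def by (intro CollectI exI [of _ ?c] exI [of _ "basis_vector ` ?B"]) auto
  qed
  ultimately show ?thesis
    unfolding twisted_matrix_grading_def B by blast
qed

text \<open>The identity element of the algebra. The \<open>one\<close> field of the record is
  \<open>undefined\<close>, so the identity is built as the sum of the diagonal idempotents.\<close>

definition unity :: "'g \<times> nat \<times> nat \<Rightarrow> 'f"
  where "unity = finsum C diag {..<length ps}"

lemma diag_carrier [simp]: "i < length ps \<Longrightarrow> diag i \<in> carrier C"
  using diag_component component_carrier by blast

lemma unity_carrier [simp]: "unity \<in> carrier C"
  unfolding unity_def by (intro abelian_monoid.finsum_closed [OF abelian_monoid_C]) auto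

lemma unity_apply:
  "unity (h, i, j) = (if h = \<one> \<and> i = j \<and> i < length ps then 1 / \<alpha> \<one> \<one> else 0)"
proof -
  have "unity (h, i, j) = (\<Sum>a<length ps. diag a (h, i, j))"
    unfolding unity_def by (simp add: finsum_apply)
  also have "\<dots> = (\<Sum>a<length ps. if a = i then if h = \<one> \<and> i = j then 1 / \<alpha> \<one> \<one> else 0 else 0)"
    by (intro sum.cong refl) (auto simp: diag_apply)
  finally show ?thesis
    by (simp add: sum.delta)
qed

lemma unity_mult:
  assumes "x \<in> carrier C"
  shows "unity \<otimes>\<^bsub>C\<^esub> x = x" "x \<otimes>\<^bsub>C\<^esub> unity = x"
proof -
  have "\<alpha> h (inv h \<otimes> k) * unity (h, i, j) * x (inv h \<otimes> k, j, l) =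
      (if h = \<one> then if j = i then x (k, i, l) else 0 else 0)"
    if "k \<in> H" "i < length ps" for h k i j l
    using that by (auto simp: unity_apply cocycle_one [of k])
  moreover have "\<alpha> h (inv h \<otimes> k) * x (h, i, j) * unity (inv h \<otimes> k, j, l) =
      (if h = k then if j = l then x (k, i, l) else 0 else 0)"
    if "h \<in> H" "k \<in> H" "l < length ps" for h k i j l
  proof -
    have "inv h \<otimes> k = \<one> \<longleftrightarrow> h = k"
      using that by (metis H_closed(4) inv_mult_cancel(2) l_inv r_one)
    then show ?thesis
      using that by (auto simp: unity_apply cocycle_one [of k])
  qed
  ultimately show "unity \<otimes>\<^bsub>C\<^esub> x = x" "x \<otimes>\<^bsub>C\<^esub> unity = x"
    using assms finite by (auto intro!: C_eqI simp: mult_apply sum_delta2)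
qed

lemma coset_trace_finsum:
  assumes "finite T" "f \<in> T \<rightarrow> carrier C"
  shows "coset_trace c (finsum C f T) = (\<Sum>t\<in>T. coset_trace c (f t))"
  unfolding coset_trace_def finsum_apply [OF assms] by (rule sum.swap)

text \<open>Makes the multiplicity of a coset in the tuple readable, as a field element, from an
  element that graded isomorphisms preserve.\<close>

lemma coset_trace_unity:
  "coset_trace c unity = of_nat (card {i. i < length ps \<and> H #> ps ! i = c}) / \<alpha> \<one> \<one>"
  by (simp add: coset_trace_def unity_apply)

end

section \<open>Basic moves on tuples\<close>

text \<open>Entries are replaced from left to right; after \<open>n\<close> moves the tuple is
  \<open>take n qs @ drop n ps\<close>.\<close>

lemma basic_moves_translate:
  assumes "length qs = length ps" and "\<And>i. i < length ps \<Longrightarrow> \<exists>h\<in>H. qs ! i = h \<otimes>\<^bsub>G\<^esub> ps ! i"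
  shows "(basic_move G)\<^sup>*\<^sup>* (H, \<alpha>, ps) (H, \<alpha>, qs)"
proof -
  have "(basic_move G)\<^sup>*\<^sup>* (H, \<alpha>, ps) (H, \<alpha>, take n qs @ drop n ps)" if "n \<le> length ps" for n
    using that
  proof (induction n)
    case (Suc n)
    let ?ps = "take n qs @ drop n ps"
    obtain h where h: "h \<in> H" "qs ! n = h \<otimes>\<^bsub>G\<^esub> ps ! n"
      using assms Suc.prems by (meson Suc_le_lessD)
    have nth: "?ps ! n = ps ! n"
      using Suc.prems assms(1) by (simp add: nth_append)
    have "?ps[n := h \<otimes>\<^bsub>G\<^esub> ?ps ! n] = take (Suc n) qs @ drop (Suc n) ps"
      using Suc.prems assms(1) h(2) unfolding nth
      by (auto intro!: nth_equalityI simp: nth_list_update nth_append min_def less_Suc_eq)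
    moreover have "basic_move G (H, \<alpha>, ?ps) (H, \<alpha>, ?ps[n := h \<otimes>\<^bsub>G\<^esub> ?ps ! n])"
      using Suc.prems assms(1) h(1) by (intro basic_move.translate) auto
    ultimately show ?case
      using Suc by (auto intro: rtranclp.rtrancl_into_rtrancl)
  qed simp
  from this [of "length ps"] show ?thesis
    using assms(1) by simp
qed

text \<open>Equal multisets allow a permutation after which the cosets agree entry by entry; each
  entry is then corrected by a factor from \<open>H\<close>.\<close>

lemma basic_moves_cosets:
  assumes "group G" "subgroup H G" "set ps \<subseteq> carrier G" "set qs \<subseteq> carrier G"
    and cosets: "mset (map (\<lambda>q. H #>\<^bsub>G\<^esub> q) qs) = mset (map (\<lambda>p. H #>\<^bsub>G\<^esub> p) ps)"
  shows "(basic_move G)\<^sup>*\<^sup>* (H, \<alpha>, ps) (H, \<alpha>, qs)"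
proof -
  obtain \<pi> where \<pi>: "\<pi> permutes {..<length ps}"
    and "permute_list \<pi> (map (\<lambda>p. H #>\<^bsub>G\<^esub> p) ps) = map (\<lambda>q. H #>\<^bsub>G\<^esub> q) qs"
    using mset_eq_permutation [OF cosets] by auto
  then have eq: "map (\<lambda>p. H #>\<^bsub>G\<^esub> p) (permute_list \<pi> ps) = map (\<lambda>q. H #>\<^bsub>G\<^esub> q) qs"
    by (simp add: permute_list_map)
  have set: "set (permute_list \<pi> ps) \<subseteq> carrier G"
    using \<pi> assms by simp
  have len: "length qs = length (permute_list \<pi> ps)"
    using eq map_eq_imp_length_eq by metis
  have "\<exists>h\<in>H. qs ! i = h \<otimes>\<^bsub>G\<^esub> permute_list \<pi> ps ! i" if "i < length (permute_list \<pi> ps)" for i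
  proof -
    have "H #>\<^bsub>G\<^esub> permute_list \<pi> ps ! i = H #>\<^bsub>G\<^esub> qs ! i"
      using that len arg_cong [OF eq, of "\<lambda>xs. xs ! i"] by simp
    moreover have "qs ! i \<in> H #>\<^bsub>G\<^esub> qs ! i"
      using that len assms by (auto intro!: group.rcos_self)
    ultimately show ?thesis
      by (auto simp: r_coset_def)
  qed
  then have "(basic_move G)\<^sup>*\<^sup>* (H, \<alpha>, permute_list \<pi> ps) (H, \<alpha>, qs)"
    using len by (intro basic_moves_translate)
  then show ?thesis
    using basic_move.permute [OF \<pi>] by (rule converse_rtranclp_into_rtranclp [rotated])
qed

section \<open>Graded isomorphisms\<close>

locale twisted_matrix_iso =
  A: twisted_matrix G H \<alpha> ps + B: twisted_matrix G K \<beta> qs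
  for G :: "('g, 'm) monoid_scheme" (structure)
    and H :: "'g set" and \<alpha> :: "'g \<Rightarrow> 'g \<Rightarrow> 'f::field" and ps :: "'g list"
    and K :: "'g set" and \<beta> :: "'g \<Rightarrow> 'g \<Rightarrow> 'f" and qs :: "'g list" +
  fixes \<theta> :: "('g \<times> nat \<times> nat \<Rightarrow> 'f) \<Rightarrow> 'g \<times> nat \<times> nat \<Rightarrow> 'f"
  assumes bij: "bij_betw \<theta> (carrier A.C) (carrier B.C)"
    and \<theta>_add: "\<lbrakk>x \<in> carrier A.C; y \<in> carrier A.C\<rbrakk> \<Longrightarrow> \<theta> (x \<oplus>\<^bsub>A.C\<^esub> y) = \<theta> x \<oplus>\<^bsub>B.C\<^esub> \<theta> y"
    and \<theta>_smult: "x \<in> carrier A.C \<Longrightarrow> \<theta> (c \<odot>\<^bsub>A.C\<^esub> x) = c \<odot>\<^bsub>B.C\<^esub> \<theta> x"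
    and \<theta>_mult: "\<lbrakk>x \<in> carrier A.C; y \<in> carrier A.C\<rbrakk> \<Longrightarrow> \<theta> (x \<otimes>\<^bsub>A.C\<^esub> y) = \<theta> x \<otimes>\<^bsub>B.C\<^esub> \<theta> y"
    and \<theta>_component: "d \<in> carrier G \<Longrightarrow> \<theta> ` A.component d = B.component d"
begin

lemma \<theta>_carrier [simp]: "x \<in> carrier A.C \<Longrightarrow> \<theta> x \<in> carrier B.C"
  using bij bij_betwE by blast

lemma \<theta>_component_closed: "d \<in> carrier G \<Longrightarrow> x \<in> A.component d \<Longrightarrow> \<theta> x \<in> B.component d"
  using \<theta>_component by blast

lemma \<theta>_zero [simp]: "\<theta> \<zero>\<^bsub>A.C\<^esub> = \<zero>\<^bsub>B.C\<^esub>"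
  using \<theta>_smult [of "\<zero>\<^bsub>A.C\<^esub>" 0] by simp

lemma \<theta>_eq_iff: "x \<in> carrier A.C \<Longrightarrow> y \<in> carrier A.C \<Longrightarrow> \<theta> x = \<theta> y \<longleftrightarrow> x = y"
  using bij by (meson bij_betw_imp_inj_on inj_on_contraD)

lemma \<theta>_nonzero: "x \<in> carrier A.C \<Longrightarrow> x \<noteq> \<zero>\<^bsub>A.C\<^esub> \<Longrightarrow> \<theta> x \<noteq> \<zero>\<^bsub>B.C\<^esub>"
  using \<theta>_eq_iff [of x "\<zero>\<^bsub>A.C\<^esub>"] by simp

lemma \<theta>_finsum:
  assumes "finite T" "f \<in> T \<rightarrow> carrier A.C"
  shows "\<theta> (finsum A.C f T) = finsum B.C (\<lambda>t. \<theta> (f t)) T"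
  using assms
proof (induction rule: finite_induct)
  case empty
  then show ?case
    by (simp add: abelian_monoid.finsum_empty [OF A.abelian_monoid_C]
        abelian_monoid.finsum_empty [OF B.abelian_monoid_C])
next
  case (insert t T)
  then show ?case
    using abelian_monoid.finsum_closed [OF A.abelian_monoid_C, of f T]
    by (simp add: abelian_monoid.finsum_insert [OF A.abelian_monoid_C]
        abelian_monoid.finsum_insert [OF B.abelian_monoid_C] \<theta>_add Pi_iff)
qed

text \<open>Preservation of the identity is not part of a graded isomorphism; it follows from
  surjectivity by multiplying with the image of a preimage of \<open>B.unity\<close>.\<close>

lemma \<theta>_unity: "\<theta> A.unity = B.unity"
proof -
  have "B.unity \<in> \<theta> ` carrier A.C"
    using bij B.unity_carrier unfolding bij_betw_def by simp
  then obtain x where x: "x \<in> carrier A.C" "\<theta> x = B.unity"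
    by auto
  have "\<theta> A.unity = \<theta> A.unity \<otimes>\<^bsub>B.C\<^esub> \<theta> x"
    using x by (simp add: B.unity_mult)
  also have "\<dots> = B.unity"
    using x \<theta>_mult [of A.unity x] by (simp add: A.unity_mult)
  finally show ?thesis .
qed

text \<open>Pulling \<open>y\<close> back along \<open>\<theta>\<close> gives a homogeneous element
  of a corner between diagonal idempotents of the first algebra, where the support argument
  applies.\<close>

lemma corner_component:
  assumes y: "y \<in> B.component d" "y \<noteq> \<zero>\<^bsub>B.C\<^esub>" "d \<in> carrier G" and a: "a < length ps" "b < length ps"
    and corner: "\<theta> (A.diag a) \<otimes>\<^bsub>B.C\<^esub> y = y" "y \<otimes>\<^bsub>B.C\<^esub> \<theta> (A.diag b) = y"
  obtains h c where "h \<in> H" "c \<noteq> 0" "d = A.basis_degree (h, a, b)"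
    "y = c \<odot>\<^bsub>B.C\<^esub> \<theta> (basis_vector (h, a, b))"
proof -
  have "y \<in> \<theta> ` A.component d"
    using \<theta>_component [OF y(3)] y(1) by simp
  then obtain x where x: "x \<in> A.component d" "\<theta> x = y"
    by auto
  then have xC: "x \<in> carrier A.C"
    using A.component_carrier by blast
  have "\<theta> (A.diag a \<otimes>\<^bsub>A.C\<^esub> x) = \<theta> x" "\<theta> (x \<otimes>\<^bsub>A.C\<^esub> A.diag b) = \<theta> x"
    using a x xC corner by (simp_all add: \<theta>_mult)
  then have "A.diag a \<otimes>\<^bsub>A.C\<^esub> x = x" "x \<otimes>\<^bsub>A.C\<^esub> A.diag b = x"
    using a xC by (simp_all add: \<theta>_eq_iff)
  moreover have "x \<noteq> \<zero>\<^bsub>A.C\<^esub>"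
    using x y by auto
  ultimately obtain h c where h: "h \<in> H" "c \<noteq> 0" "d = A.basis_degree (h, a, b)"
    "x = c \<odot>\<^bsub>A.C\<^esub> basis_vector (h, a, b)"
    using A.corner_component x a by metis
  then have "y = c \<odot>\<^bsub>B.C\<^esub> \<theta> (basis_vector (h, a, b))"
    using x(2) a A.basis_vector_component A.component_carrier \<theta>_smult by metis
  then show thesis
    using that h by blast
qed

text \<open>Together with \<open>corner_component\<close> this makes every nonzero homogeneous
  element of a diagonal corner invertible on the right within that corner.\<close>

lemma basis_vector_inverse:
  assumes "h \<in> H" "a < length ps"
  obtains x where "x \<in> A.component (inv (A.basis_degree (h, a, a)))"
    "basis_vector (h, a, a) \<otimes>\<^bsub>A.C\<^esub> x = A.diag a" "x \<otimes>\<^bsub>A.C\<^esub> A.diag a = x"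
proof
  let ?u = "basis_vector (inv h, a, a) :: 'g \<times> nat \<times> nat \<Rightarrow> 'f"
  \<comment> \<open>The product of the two basis vectors is \<open>\<alpha> h (inv h)\<close> times
    \<open>basis_vector (\<one>, a, a)\<close>, and the latter is
    \<open>\<alpha> \<one> \<one>\<close> times \<open>A.diag a\<close>.\<close>
  let ?x = "(1 / (\<alpha> h (inv h) * \<alpha> \<one> \<one>)) \<odot>\<^bsub>A.C\<^esub> ?u"
  have "inv (A.basis_degree (h, a, a)) = A.basis_degree (inv h, a, a)"
    using assms by (simp add: A.basis_degree_def A.inv_mult_group A.m_assoc)
  then show "?x \<in> A.component (inv (A.basis_degree (h, a, a)))"
    using assms by (simp add: A.basis_vector_component A.component_smult)
  show "?x \<otimes>\<^bsub>A.C\<^esub> A.diag a = ?x"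
    using assms by simp
  show "basis_vector (h, a, a) \<otimes>\<^bsub>A.C\<^esub> ?x = A.diag a"
    using assms by (simp add: A.diag_def A.mult_basis_vector)
qed

text \<open>Equivalence of the two idempotents inside the degree-one component: primeness produces a
  nonzero, hence invertible, homogeneous element of the corner at \<open>\<theta> (A.diag a)\<close>
  that factors through \<open>B.diag i\<close>.\<close>

lemma idempotent_equivalent:
  assumes a: "a < length ps"
  obtains i v w where "i < length qs" "v \<in> B.component \<one>" "w \<in> B.component \<one>"
    "v \<otimes>\<^bsub>B.C\<^esub> w = \<theta> (A.diag a)" "w \<otimes>\<^bsub>B.C\<^esub> v = B.diag i" "v \<otimes>\<^bsub>B.C\<^esub> B.diag i = v" "B.diag i \<otimes>\<^bsub>B.C\<^esub> w = w"
proof -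
  define f where "f = \<theta> (A.diag a)"
  have f: "f \<in> B.component \<one>" "f \<otimes>\<^bsub>B.C\<^esub> f = f" "f \<noteq> \<zero>\<^bsub>B.C\<^esub>"
    using a unfolding f_def
    by (simp_all add: \<theta>_mult [symmetric] \<theta>_nonzero A.diag_nonzero \<theta>_component_closed A.diag_component)
  then have fC: "f \<in> carrier B.C"
    using B.component_carrier by blast
  \<comment> \<open>Any column \<open>i\<close> in which \<open>f\<close> has a nonzero coefficient
    will do: cutting \<open>f\<close> down to it leaves a nonzero element.\<close>
  then obtain h j i where "f (h, j, i) \<noteq> 0" and i: "i < length qs"
    using f B.C_nonzero_obtain by blast
  then have nz: "f \<otimes>\<^bsub>B.C\<^esub> B.diag i \<noteq> \<zero>\<^bsub>B.C\<^esub>"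
    using B.mult_diag_apply [OF fC i, of h j i] by (auto simp: B.zero_apply)
  define v where "v = f \<otimes>\<^bsub>B.C\<^esub> B.diag i"
  have v: "v \<in> B.component \<one>" "f \<otimes>\<^bsub>B.C\<^esub> v = v" "v \<otimes>\<^bsub>B.C\<^esub> B.diag i = v"
    using f i B.component_mult [OF f(1) B.diag_component [OF i]]
    by (simp_all add: v_def B.mult_assoc [symmetric]) (simp add: B.mult_assoc)
  \<comment> \<open>The element \<open>v z f\<close> is nonzero, homogeneous and lies in the corner
    of \<open>f\<close>, so it is a multiple of the image of a single basis vector.\<close>
  obtain z d where d: "d \<in> carrier G" and z: "z \<in> B.component d"
    and y: "v \<otimes>\<^bsub>B.C\<^esub> z \<otimes>\<^bsub>B.C\<^esub> f \<noteq> \<zero>\<^bsub>B.C\<^esub>"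
    using B.mult_nonzero [OF v(1) _ fC f(3)] nz v_def by metis
  have "v \<otimes>\<^bsub>B.C\<^esub> z \<otimes>\<^bsub>B.C\<^esub> f \<in> B.component d"
    using B.component_mult [OF B.component_mult [OF v(1) z] f(1)] d by simp
  moreover have "f \<otimes>\<^bsub>B.C\<^esub> (v \<otimes>\<^bsub>B.C\<^esub> z \<otimes>\<^bsub>B.C\<^esub> f) = v \<otimes>\<^bsub>B.C\<^esub> z \<otimes>\<^bsub>B.C\<^esub> f"
    using v by (simp add: B.mult_assoc [symmetric])
  moreover have "(v \<otimes>\<^bsub>B.C\<^esub> z \<otimes>\<^bsub>B.C\<^esub> f) \<otimes>\<^bsub>B.C\<^esub> f = v \<otimes>\<^bsub>B.C\<^esub> z \<otimes>\<^bsub>B.C\<^esub> f"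
    using f by (simp add: B.mult_assoc)
  ultimately obtain h c where h: "h \<in> H" "c \<noteq> 0" "d = A.basis_degree (h, a, a)"
    and y_eq: "v \<otimes>\<^bsub>B.C\<^esub> z \<otimes>\<^bsub>B.C\<^esub> f = c \<odot>\<^bsub>B.C\<^esub> \<theta> (basis_vector (h, a, a))"
    using corner_component [OF _ y d a a] unfolding f_def by metis
  obtain x where x: "x \<in> A.component (inv d)" "basis_vector (h, a, a) \<otimes>\<^bsub>A.C\<^esub> x = A.diag a"
    "x \<otimes>\<^bsub>A.C\<^esub> A.diag a = x"
    using basis_vector_inverse [OF h(1) a] h(3) by metis
  have xC: "x \<in> carrier A.C" and uC: "basis_vector (h, a, a) \<in> carrier A.C"
    using x(1) A.basis_vector_component [OF h(1) a a] A.component_carrier by blast+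
  define x' where "x' = (1 / c) \<odot>\<^bsub>B.C\<^esub> \<theta> x"
  have x': "x' \<in> B.component (inv d)" "v \<otimes>\<^bsub>B.C\<^esub> z \<otimes>\<^bsub>B.C\<^esub> f \<otimes>\<^bsub>B.C\<^esub> x' = f"
    using x xC uC h y_eq d \<theta>_mult [OF uC xC]
    by (simp_all add: x'_def f_def B.component_smult \<theta>_component_closed)
  \<comment> \<open>The factor \<open>x'\<close> inverts \<open>v z f\<close> on the right, so the
    rest of the product, cut down by \<open>B.diag i\<close>, is a partner of \<open>v\<close>. The
    degrees \<open>d\<close> and \<open>inv d\<close> cancel.\<close>
  define w where "w = B.diag i \<otimes>\<^bsub>B.C\<^esub> z \<otimes>\<^bsub>B.C\<^esub> f \<otimes>\<^bsub>B.C\<^esub> x'"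
  have w: "w \<in> B.component \<one>" "B.diag i \<otimes>\<^bsub>B.C\<^esub> w = w"
    using i d B.component_mult [OF B.component_mult
        [OF B.component_mult [OF B.diag_component [OF i] z] f(1)] x'(1)]
    by (simp_all add: w_def B.mult_assoc [symmetric])
  have vw: "v \<otimes>\<^bsub>B.C\<^esub> w = f"
    using v x' by (simp add: w_def B.mult_assoc [symmetric])
  \<comment> \<open>This serves twice: it shows that \<open>w v\<close> is nonzero, and it later
    forces the scalar relating \<open>w v\<close> to \<open>B.diag i\<close> to be 1.\<close>
  have vwv: "v \<otimes>\<^bsub>B.C\<^esub> (w \<otimes>\<^bsub>B.C\<^esub> v) \<otimes>\<^bsub>B.C\<^esub> w = f"
    using vw v by (simp add: B.mult_assoc [symmetric] vw)
  have wv: "w \<otimes>\<^bsub>B.C\<^esub> v \<in> B.component \<one>"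
    using B.component_mult [OF w(1) v(1)] by simp
  have "w \<otimes>\<^bsub>B.C\<^esub> v \<noteq> \<zero>\<^bsub>B.C\<^esub>"
    using vwv f by auto
  moreover have "B.diag i \<otimes>\<^bsub>B.C\<^esub> (w \<otimes>\<^bsub>B.C\<^esub> v) = w \<otimes>\<^bsub>B.C\<^esub> v" "(w \<otimes>\<^bsub>B.C\<^esub> v) \<otimes>\<^bsub>B.C\<^esub> B.diag i = w \<otimes>\<^bsub>B.C\<^esub> v"
    using w v by (simp add: B.mult_assoc [symmetric], simp add: B.mult_assoc)
  ultimately obtain k c' where k: "k \<in> K" "\<one> = B.basis_degree (k, i, i)"
    "w \<otimes>\<^bsub>B.C\<^esub> v = c' \<odot>\<^bsub>B.C\<^esub> basis_vector (k, i, i)"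
    using B.corner_component [OF wv _ i i] by metis
  \<comment> \<open>The degree-one component of the corner at \<open>i\<close> is therefore spanned
    by \<open>B.diag i\<close>.\<close>
  then have "k = \<one>"
    by (metis B.H_closed(1) B.basis_degree_eq_iff B.basis_degree_one_diag i)
  then have wv_eq: "w \<otimes>\<^bsub>B.C\<^esub> v = (c' * \<beta> \<one> \<one>) \<odot>\<^bsub>B.C\<^esub> B.diag i"
    using k by (simp add: B.diag_def)
  have "(c' * \<beta> \<one> \<one>) \<odot>\<^bsub>B.C\<^esub> f = 1 \<odot>\<^bsub>B.C\<^esub> f"
    using vwv vw v unfolding wv_eq by simp
  then have "c' * \<beta> \<one> \<one> = 1"
    using f B.C_nonzero_obtain [OF fC f(3)] by (metis B.smult_apply mult_right_cancel)
  then have "w \<otimes>\<^bsub>B.C\<^esub> v = B.diag i"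
    using wv_eq by simp
  then show thesis
    using that [OF i v(1) w(1) _ _ v(3) w(2)] vw f_def by blast
qed

end

lemma count_mset_map: "count (mset (map f xs)) c = card {i. i < length xs \<and> f (xs ! i) = c}"
proof -
  have "count (mset (map f xs)) c = length (filter (\<lambda>x. f x = c) xs)"
    by (induction xs) auto
  then show ?thesis
    by (simp add: length_filter_conv_card)
qed

lemma graded_isomorphicE:
  assumes "graded_isomorphic G A \<Gamma> B \<Delta>"
  obtains \<phi> where "bij_betw \<phi> (carrier A) (carrier B)"
    and "\<And>x y. x \<in> carrier A \<Longrightarrow> y \<in> carrier A \<Longrightarrow> \<phi> (x \<oplus>\<^bsub>A\<^esub> y) = \<phi> x \<oplus>\<^bsub>B\<^esub> \<phi> y"
    and "\<And>c x. x \<in> carrier A \<Longrightarrow> \<phi> (c \<odot>\<^bsub>A\<^esub> x) = c \<odot>\<^bsub>B\<^esub> \<phi> x"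
    and "\<And>x y. x \<in> carrier A \<Longrightarrow> y \<in> carrier A \<Longrightarrow> \<phi> (x \<otimes>\<^bsub>A\<^esub> y) = \<phi> x \<otimes>\<^bsub>B\<^esub> \<phi> y"
    and "\<And>g. g \<in> carrier G \<Longrightarrow> \<phi> ` \<Gamma> g = \<Delta> g"
  using assms unfolding graded_isomorphic_def
proof (elim exE conjE, goal_cases)
  case (1 \<phi>)
  show ?case
    by (rule that [of \<phi>]) (use 1(2-) in simp_all)
qed

section \<open>Comparison of corners and of coset multiplicities\<close>

context twisted_matrix_iso
begin

text \<open>Since \<open>v\<close>, \<open>w\<close>, \<open>v'\<close> and \<open>w'\<close> link
  the idempotents, multiplying the image by \<open>v\<close> and \<open>w'\<close> recovers
  \<open>\<theta> (basis_vector (h, a, b))\<close>, so the image is nonzero. The factors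
  \<open>w\<close> and \<open>v'\<close> have degree \<open>\<one>\<close>, so the degree is
  kept.\<close>

lemma corner_image:
  assumes a: "a < length ps" "b < length ps" and i: "i < length qs" "j < length qs"
    and v: "v \<in> B.component \<one>" "v \<otimes>\<^bsub>B.C\<^esub> w = \<theta> (A.diag a)" "B.diag i \<otimes>\<^bsub>B.C\<^esub> w = w" "w \<in> B.component \<one>"
    and v': "v' \<in> B.component \<one>" "v' \<otimes>\<^bsub>B.C\<^esub> w' = \<theta> (A.diag b)" "v' \<otimes>\<^bsub>B.C\<^esub> B.diag j = v'"
    and h: "h \<in> H"
  obtains k t where "k \<in> K" "t \<noteq> 0" "A.basis_degree (h, a, b) = B.basis_degree (k, i, j)"
    "w \<otimes>\<^bsub>B.C\<^esub> \<theta> (basis_vector (h, a, b)) \<otimes>\<^bsub>B.C\<^esub> v' = t \<odot>\<^bsub>B.C\<^esub> basis_vector (k, i, j)"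
proof -
  let ?d = "A.basis_degree (h, a, b)"
  let ?u = "basis_vector (h, a, b) :: 'g \<times> nat \<times> nat \<Rightarrow> 'f"
  let ?y = "w \<otimes>\<^bsub>B.C\<^esub> \<theta> ?u \<otimes>\<^bsub>B.C\<^esub> v'"
  have u: "?u \<in> A.component ?d" and d: "?d \<in> carrier G"
    using A.basis_vector_component A.basis_degree_closed h a by blast+
  then have uC: "?u \<in> carrier A.C"
    using A.component_carrier by blast
  have y: "?y \<in> B.component ?d"
    using B.component_mult [OF B.component_mult [OF v(4) \<theta>_component_closed [OF d u]] v'(1)] d by simp
  have "v \<otimes>\<^bsub>B.C\<^esub> ?y \<otimes>\<^bsub>B.C\<^esub> w' = (v \<otimes>\<^bsub>B.C\<^esub> w) \<otimes>\<^bsub>B.C\<^esub> \<theta> ?u \<otimes>\<^bsub>B.C\<^esub> (v' \<otimes>\<^bsub>B.C\<^esub> w')"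
    by (simp add: B.mult_assoc)
  also have "\<dots> = \<theta> ?u"
    using a h uC unfolding v v' by (simp add: \<theta>_mult [symmetric])
  finally have "v \<otimes>\<^bsub>B.C\<^esub> ?y \<otimes>\<^bsub>B.C\<^esub> w' \<noteq> \<zero>\<^bsub>B.C\<^esub>"
    using \<theta>_nonzero [OF uC] by simp
  then have nz: "?y \<noteq> \<zero>\<^bsub>B.C\<^esub>"
    by auto
  have "B.diag i \<otimes>\<^bsub>B.C\<^esub> ?y = ?y" "?y \<otimes>\<^bsub>B.C\<^esub> B.diag j = ?y"
    using v v' by (simp add: B.mult_assoc [symmetric], simp add: B.mult_assoc)
  then show thesis
    using that B.corner_component [OF y nz i] by metis
qed

text \<open>The trace of \<open>\<theta> A.unity\<close> is evaluated twice: as the trace of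
  \<open>B.unity\<close>, and as a sum over \<open>\<theta> (A.diag a)\<close>, where
  \<open>coset_trace_commute\<close> replaces \<open>v w\<close> by \<open>w v\<close>. The result
  is an equality in the field only.\<close>

lemma coset_count:
  assumes \<sigma>: "\<And>a. a < length ps \<Longrightarrow> \<sigma> a < length qs"
    "\<And>a. a < length ps \<Longrightarrow> v a \<in> B.component \<one>" "\<And>a. a < length ps \<Longrightarrow> w a \<in> B.component \<one>"
    "\<And>a. a < length ps \<Longrightarrow> v a \<otimes>\<^bsub>B.C\<^esub> w a = \<theta> (A.diag a)"
    "\<And>a. a < length ps \<Longrightarrow> w a \<otimes>\<^bsub>B.C\<^esub> v a = B.diag (\<sigma> a)"
  shows "(of_nat (card {i. i < length qs \<and> K #> qs ! i = c}) :: 'f) =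
    of_nat (card {a. a < length ps \<and> K #> qs ! \<sigma> a = c})"
proof -
  have "of_nat (card {i. i < length qs \<and> K #> qs ! i = c}) / \<beta> \<one> \<one> = B.coset_trace c (\<theta> A.unity)"
    by (simp add: \<theta>_unity B.coset_trace_unity)
  also have "\<dots> = (\<Sum>a<length ps. B.coset_trace c (\<theta> (A.diag a)))"
    unfolding A.unity_def by (simp add: \<theta>_finsum B.coset_trace_finsum)
  also have "\<dots> = (\<Sum>a<length ps. B.coset_trace c (B.diag (\<sigma> a)))"
  proof (rule sum.cong [OF refl])
    fix a assume "a \<in> {..<length ps}"
    then have a: "a < length ps"
      by simp
    show "B.coset_trace c (\<theta> (A.diag a)) = B.coset_trace c (B.diag (\<sigma> a))"
      using B.coset_trace_commute [OF \<sigma>(2,3) [OF a]] unfolding \<sigma>(4,5) [OF a] .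
  qed
  also have "\<dots> = (\<Sum>a<length ps. if K #> qs ! \<sigma> a = c then 1 / \<beta> \<one> \<one> else 0)"
    using \<sigma>(1) by (intro sum.cong refl) (simp add: B.coset_trace_diag)
  also have "\<dots> = of_nat (card {a. a < length ps \<and> K #> qs ! \<sigma> a = c}) / \<beta> \<one> \<one>"
    by (simp add: sum.If_cases Int_def)
  finally show ?thesis
    by simp
qed

end

section \<open>From a graded isomorphism to basic moves and a coboundary\<close>

lemma twisted_matrix_iso_imp_equivalent:
  fixes \<alpha> \<beta> :: "'g \<Rightarrow> 'g \<Rightarrow> 'f :: field_char_0"
  assumes "twisted_matrix_iso G H \<alpha> ps K \<beta> qs \<theta>" and ps: "ps \<noteq> []"
  shows "equivalent_presentations G (H, \<alpha>, ps) (K, \<beta>, qs)"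
proof -
  interpret twisted_matrix_iso G H \<alpha> ps K \<beta> qs \<theta>
    by fact
  note [simp] = A.m_assoc A.inv_mult_group
  \<comment> \<open>Bundles the equivalence data so that \<open>\<sigma>\<close>, \<open>v\<close>
    and \<open>w\<close> can be chosen simultaneously for all indices.\<close>
  define P where "P a i v w \<longleftrightarrow> i < length qs \<and> v \<in> B.component \<one>\<^bsub>G\<^esub> \<and> w \<in> B.component \<one>\<^bsub>G\<^esub> \<and>
    v \<otimes>\<^bsub>B.C\<^esub> w = \<theta> (A.diag a) \<and> w \<otimes>\<^bsub>B.C\<^esub> v = B.diag i \<and> v \<otimes>\<^bsub>B.C\<^esub> B.diag i = v \<and> B.diag i \<otimes>\<^bsub>B.C\<^esub> w = w" for a i v w
  have "\<forall>a. \<exists>i v w. a < length ps \<longrightarrow> P a i v w"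
    using idempotent_equivalent unfolding P_def by metis
  then obtain \<sigma> v w where "\<forall>a. a < length ps \<longrightarrow> P a (\<sigma> a) (v a) (w a)"
    by metis
  then have \<sigma>: "\<sigma> a < length qs" and v: "v a \<in> B.component \<one>\<^bsub>G\<^esub>" and w: "w a \<in> B.component \<one>\<^bsub>G\<^esub>"
    and vw: "v a \<otimes>\<^bsub>B.C\<^esub> w a = \<theta> (A.diag a)" and wv: "w a \<otimes>\<^bsub>B.C\<^esub> v a = B.diag (\<sigma> a)"
    and vE: "v a \<otimes>\<^bsub>B.C\<^esub> B.diag (\<sigma> a) = v a" and Ew: "B.diag (\<sigma> a) \<otimes>\<^bsub>B.C\<^esub> w a = w a"
    if "a < length ps" for a
    using that unfolding P_def by blast+
  have pos: "0 < length ps"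
    using ps by simp
  note \<sigma>0 = \<sigma> [OF pos]
  let ?p = "ps ! 0" and ?q = "qs ! \<sigma> 0"
  \<comment> \<open>Chosen so that \<open>g\<close> sends the entry \<open>?p\<close> to
    \<open>?q\<close>.\<close>
  define g where "g = ?q \<otimes>\<^bsub>G\<^esub> inv\<^bsub>G\<^esub> ?p"
  have p: "?p \<in> carrier G" and q: "?q \<in> carrier G" and g: "g \<in> carrier G"
    using pos \<sigma>0 by (auto simp: g_def)

  have coset: "K #>\<^bsub>G\<^esub> (g \<otimes>\<^bsub>G\<^esub> ps ! a) = K #>\<^bsub>G\<^esub> qs ! \<sigma> a" if a: "a < length ps" for a
  proof -
    \<comment> \<open>Comparing the degree of the matrix unit at (\<open>0\<close>,
      \<open>a\<close>) with that of its image relates \<open>ps ! a\<close> to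
      \<open>qs ! \<sigma> a\<close> up to a factor \<open>k\<close> in \<open>K\<close>.\<close>
    obtain k where k: "k \<in> K" "A.basis_degree (\<one>\<^bsub>G\<^esub>, 0, a) = B.basis_degree (k, \<sigma> 0, \<sigma> a)"
      using corner_image [OF pos a \<sigma>0 \<sigma> [OF a] v [OF pos] vw [OF pos] Ew [OF pos] w [OF pos]
          v [OF a] vw [OF a] vE [OF a] A.H_closed(1)] by metis
    have "g \<otimes>\<^bsub>G\<^esub> ps ! a = ?q \<otimes>\<^bsub>G\<^esub> A.basis_degree (\<one>\<^bsub>G\<^esub>, 0, a)"
      using a p q by (simp add: g_def A.basis_degree_def)
    also have "\<dots> = k \<otimes>\<^bsub>G\<^esub> qs ! \<sigma> a"
      using k q \<sigma> [OF a] by (simp add: B.basis_degree_def)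
    finally show ?thesis
      using k \<sigma> [OF a] by (simp add: B.coset_eq)
  qed

  have "mset (map (\<lambda>q. K #>\<^bsub>G\<^esub> q) qs) = mset (map (\<lambda>p. K #>\<^bsub>G\<^esub> p) (map (\<lambda>p. g \<otimes>\<^bsub>G\<^esub> p) ps))"
  proof (rule multiset_eqI)
    fix c
    \<comment> \<open>Characteristic zero enters here: \<open>of_nat\<close> is injective, so the
      equality in the field becomes one of multiplicities.\<close>
    have "card {i. i < length qs \<and> K #>\<^bsub>G\<^esub> qs ! i = c} =
        card {a. a < length ps \<and> K #>\<^bsub>G\<^esub> qs ! \<sigma> a = c}"
      using coset_count [OF \<sigma> v w vw wv, of c] of_nat_eq_iff by blast
    also have "{a. a < length ps \<and> K #>\<^bsub>G\<^esub> qs ! \<sigma> a = c} =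
        {a. a < length ps \<and> K #>\<^bsub>G\<^esub> (g \<otimes>\<^bsub>G\<^esub> ps ! a) = c}"
      using coset by auto
    finally show "count (mset (map (\<lambda>q. K #>\<^bsub>G\<^esub> q) qs)) c =
        count (mset (map (\<lambda>p. K #>\<^bsub>G\<^esub> p) (map (\<lambda>p. g \<otimes>\<^bsub>G\<^esub> p) ps))) c"
      by (simp add: count_mset_map cong: conj_cong del: mset_map)
  qed
  \<comment> \<open>Permutations and translations leave the cocycle alone; it is kept arbitrary so
    that the conjugated cocycle can be inserted later.\<close>
  then have moves: "(basic_move G)\<^sup>*\<^sup>* (K, \<gamma>, map (\<lambda>p. g \<otimes>\<^bsub>G\<^esub> p) ps) (K, \<gamma>, qs)" for \<gamma> :: "'g \<Rightarrow> 'g \<Rightarrow> 'f"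
    using g A.ps_carrier B.ps_carrier B.subgroup
    by (intro basic_moves_cosets) auto

  define \<kappa> where "\<kappa> h = g \<otimes>\<^bsub>G\<^esub> h \<otimes>\<^bsub>G\<^esub> inv\<^bsub>G\<^esub> g" for h
  \<comment> \<open>Equality of the degrees at the corners of \<open>?p\<close> and
    \<open>?q\<close>, solved for \<open>k\<close>, is conjugation by \<open>g\<close>.\<close>
  have \<kappa>: "k = \<kappa> h" if "h \<in> H" "k \<in> K" "A.basis_degree (h, 0, 0) = B.basis_degree (k, \<sigma> 0, \<sigma> 0)" for h k
  proof -
    have "\<kappa> h = ?q \<otimes>\<^bsub>G\<^esub> A.basis_degree (h, 0, 0) \<otimes>\<^bsub>G\<^esub> inv\<^bsub>G\<^esub> ?q"
      using that(1) p q by (simp add: \<kappa>_def g_def A.basis_degree_def)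
    also have "\<dots> = k"
      unfolding that(3) using that(1,2) q by (simp add: B.basis_degree_def)
    finally show ?thesis ..
  qed
  define u where "u h = (basis_vector (h, 0, 0) :: 'g \<times> nat \<times> nat \<Rightarrow> 'f)" for h
  define u' where "u' k = (basis_vector (k, \<sigma> 0, \<sigma> 0) :: 'g \<times> nat \<times> nat \<Rightarrow> 'f)" for k
  define \<psi> where "\<psi> x = w 0 \<otimes>\<^bsub>B.C\<^esub> \<theta> x \<otimes>\<^bsub>B.C\<^esub> v 0" for x
  have uC: "u h \<in> carrier A.C" if "h \<in> H" for h
    using A.basis_vector_component A.component_carrier that pos unfolding u_def by blast
  have "\<forall>h. \<exists>t. h \<in> H \<longrightarrow> \<kappa> h \<in> K \<and> t \<noteq> 0 \<and> \<psi> (u h) = t \<odot>\<^bsub>B.C\<^esub> u' (\<kappa> h)"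
    unfolding \<psi>_def u_def u'_def
    using corner_image [OF pos pos \<sigma>0 \<sigma>0 v [OF pos] vw [OF pos] Ew [OF pos] w [OF pos]
        v [OF pos] vw [OF pos] vE [OF pos]] \<kappa> by metis
  then obtain t where t: "\<kappa> h \<in> K" "t h \<noteq> 0" "\<psi> (u h) = t h \<odot>\<^bsub>B.C\<^esub> u' (\<kappa> h)" if "h \<in> H" for h
    by metis

  \<comment> \<open>On the corner at index 0 the map \<open>\<psi>\<close> is multiplicative,
    because \<open>v 0\<close> times \<open>w 0\<close> is the image of \<open>A.diag 0\<close>.
    Comparing coefficients of products of basis vectors relates the two cocycles.\<close>
  have \<psi>_mult: "t h * t h' * \<beta> (\<kappa> h) (\<kappa> h') = \<alpha> h h' * t (h \<otimes>\<^bsub>G\<^esub> h')" if h: "h \<in> H" "h' \<in> H" for h h'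
  proof -
    have hh': "h \<otimes>\<^bsub>G\<^esub> h' \<in> H" and \<kappa>_mult: "\<kappa> h \<otimes>\<^bsub>G\<^esub> \<kappa> h' = \<kappa> (h \<otimes>\<^bsub>G\<^esub> h')"
      using h g by (simp_all add: \<kappa>_def)
    have "\<psi> (u h) \<otimes>\<^bsub>B.C\<^esub> \<psi> (u h') =
        w 0 \<otimes>\<^bsub>B.C\<^esub> (\<theta> (u h) \<otimes>\<^bsub>B.C\<^esub> (v 0 \<otimes>\<^bsub>B.C\<^esub> w 0) \<otimes>\<^bsub>B.C\<^esub> \<theta> (u h')) \<otimes>\<^bsub>B.C\<^esub> v 0"
      by (simp add: \<psi>_def B.mult_assoc)
    also have "\<dots> = \<psi> (u h \<otimes>\<^bsub>A.C\<^esub> A.diag 0 \<otimes>\<^bsub>A.C\<^esub> u h')"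
      using uC h pos by (simp add: \<psi>_def vw \<theta>_mult)
    also have "u h \<otimes>\<^bsub>A.C\<^esub> A.diag 0 \<otimes>\<^bsub>A.C\<^esub> u h' = \<alpha> h h' \<odot>\<^bsub>A.C\<^esub> u (h \<otimes>\<^bsub>G\<^esub> h')"
      using h pos by (simp add: u_def A.mult_basis_vector)
    also have "\<psi> \<dots> = (\<alpha> h h' * t (h \<otimes>\<^bsub>G\<^esub> h')) \<odot>\<^bsub>B.C\<^esub> u' (\<kappa> (h \<otimes>\<^bsub>G\<^esub> h'))"
      using uC hh' t(3) [OF hh'] by (simp add: \<psi>_def \<theta>_smult)
    finally have "(t h * t h' * \<beta> (\<kappa> h) (\<kappa> h')) \<odot>\<^bsub>B.C\<^esub> u' (\<kappa> (h \<otimes>\<^bsub>G\<^esub> h')) =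
        (\<alpha> h h' * t (h \<otimes>\<^bsub>G\<^esub> h')) \<odot>\<^bsub>B.C\<^esub> u' (\<kappa> (h \<otimes>\<^bsub>G\<^esub> h'))"
      using h t \<sigma>0 \<kappa>_mult
      by (simp add: u'_def B.mult_basis_vector mult_ac)
    then show ?thesis
      by (auto simp: u'_def B.smult_apply basis_vector_def dest: fun_cong [of _ _ "(\<kappa> (h \<otimes>\<^bsub>G\<^esub> h'), \<sigma> 0, \<sigma> 0)"])
  qed

  \<comment> \<open>The same comparison run backwards: multiplying by \<open>v 0\<close> and
    \<open>w 0\<close> carries a basis vector of the second corner to a nonzero element of the
    first.\<close>
  have \<kappa>_surj: "k \<in> \<kappa> ` H" if k: "k \<in> K" for k
  proof -
    let ?d = "B.basis_degree (k, \<sigma> 0, \<sigma> 0)"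
    let ?y = "v 0 \<otimes>\<^bsub>B.C\<^esub> u' k \<otimes>\<^bsub>B.C\<^esub> w 0"
    have d: "?d \<in> carrier G"
      using B.basis_degree_closed k \<sigma>0 by blast
    have "u' k \<in> B.component ?d"
      using B.basis_vector_component k \<sigma>0 unfolding u'_def by blast
    then have y: "?y \<in> B.component ?d"
      using B.component_mult [OF B.component_mult [OF v [OF pos]] w [OF pos]] d by fastforce
    have "w 0 \<otimes>\<^bsub>B.C\<^esub> ?y \<otimes>\<^bsub>B.C\<^esub> v 0 = B.diag (\<sigma> 0) \<otimes>\<^bsub>B.C\<^esub> u' k \<otimes>\<^bsub>B.C\<^esub> B.diag (\<sigma> 0)"
      using pos by (simp add: B.mult_assoc wv [symmetric])
    also have "\<dots> = u' k"
      using k \<sigma>0 by (simp add: u'_def)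
    finally have "w 0 \<otimes>\<^bsub>B.C\<^esub> ?y \<otimes>\<^bsub>B.C\<^esub> v 0 \<noteq> \<zero>\<^bsub>B.C\<^esub>"
      by (simp add: u'_def)
    then have nz: "?y \<noteq> \<zero>\<^bsub>B.C\<^esub>"
      by auto
    have "\<theta> (A.diag 0) \<otimes>\<^bsub>B.C\<^esub> v 0 = v 0" "w 0 \<otimes>\<^bsub>B.C\<^esub> \<theta> (A.diag 0) = w 0"
      using pos vE Ew by (simp add: vw [symmetric] B.mult_assoc wv,
          simp add: vw [symmetric] B.mult_assoc [symmetric] wv)
    then have "\<theta> (A.diag 0) \<otimes>\<^bsub>B.C\<^esub> ?y = ?y" "?y \<otimes>\<^bsub>B.C\<^esub> \<theta> (A.diag 0) = ?y"
      by (simp add: B.mult_assoc [symmetric], simp add: B.mult_assoc)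
    then obtain h where "h \<in> H" "?d = A.basis_degree (h, 0, 0)"
      using corner_component [OF y nz d pos pos] by metis
    then show ?thesis
      using \<kappa> [of h k] k by auto
  qed
  then have K: "K = \<kappa> ` H"
    using t(1) by auto

  let ?\<alpha>' = "\<lambda>x y. \<alpha> (inv\<^bsub>G\<^esub> g \<otimes>\<^bsub>G\<^esub> x \<otimes>\<^bsub>G\<^esub> g) (inv\<^bsub>G\<^esub> g \<otimes>\<^bsub>G\<^esub> y \<otimes>\<^bsub>G\<^esub> g)"
  have "basic_move G (H, \<alpha>, ps) (K, ?\<alpha>', map (\<lambda>p. g \<otimes>\<^bsub>G\<^esub> p) ps)"
    using basic_move.conjugate [OF g, of H \<alpha> ps] unfolding K \<kappa>_def .
  then have "(basic_move G)\<^sup>*\<^sup>* (H, \<alpha>, ps) (K, ?\<alpha>', qs)"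
    using moves by (rule converse_rtranclp_into_rtranclp)
  moreover have "cohomologous G K ?\<alpha>' \<beta>"
    unfolding cohomologous_def
  proof (intro exI conjI ballI)
    let ?\<rho> = "\<lambda>k. inv\<^bsub>G\<^esub> g \<otimes>\<^bsub>G\<^esub> k \<otimes>\<^bsub>G\<^esub> g"
    have \<rho>: "?\<rho> (\<kappa> h) = h" if "h \<in> H" for h
      using that g by (simp add: \<kappa>_def)
    \<comment> \<open>The coboundary is given by the reciprocal of \<open>t\<close>, transported to
      \<open>K\<close> by \<open>?\<rho>\<close>, which undoes \<open>\<kappa>\<close>: this is
      \<open>\<psi>_mult\<close> solved for \<beta>.\<close>
    show "1 / t (?\<rho> k) \<noteq> 0" if "k \<in> K" for k
      using that t(2) \<rho> unfolding K by auto
    fix k k' assume "k \<in> K" "k' \<in> K"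
    then obtain h h' where h: "h \<in> H" "h' \<in> H" and k: "k = \<kappa> h" "k' = \<kappa> h'"
      unfolding K by auto
    have kk': "k \<otimes>\<^bsub>G\<^esub> k' = \<kappa> (h \<otimes>\<^bsub>G\<^esub> h')"
      using h g by (simp add: k \<kappa>_def)
    show "\<beta> k k' = 1 / t (?\<rho> k) * (1 / t (?\<rho> k')) / (1 / t (?\<rho> (k \<otimes>\<^bsub>G\<^esub> k'))) * ?\<alpha>' k k'"
      unfolding kk' unfolding k using h t(2) [OF h(1)] t(2) [OF h(2)] \<psi>_mult [OF h]
      by (simp only: \<rho> A.H_closed) (simp add: field_simps)
  qed
  ultimately show ?thesis
    by auto
qed

section \<open>Symmetry and transitivity of graded isomorphism, and the reduction to concrete
  algebras\<close>

lemma graded_isomorphic_sym: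
  assumes A: "graded_algebra G A \<Gamma>" and iso: "graded_isomorphic G A \<Gamma> B \<Delta>"
  shows "graded_isomorphic G B \<Delta> A \<Gamma>"
proof -
  interpret graded_algebra G A \<Gamma>
    by fact
  obtain \<phi> where bij: "bij_betw \<phi> (carrier A) (carrier B)"
    and add: "\<And>x y. x \<in> carrier A \<Longrightarrow> y \<in> carrier A \<Longrightarrow> \<phi> (x \<oplus>\<^bsub>A\<^esub> y) = \<phi> x \<oplus>\<^bsub>B\<^esub> \<phi> y"
    and smult: "\<And>c x. x \<in> carrier A \<Longrightarrow> \<phi> (c \<odot>\<^bsub>A\<^esub> x) = c \<odot>\<^bsub>B\<^esub> \<phi> x"
    and mult: "\<And>x y. x \<in> carrier A \<Longrightarrow> y \<in> carrier A \<Longrightarrow> \<phi> (x \<otimes>\<^bsub>A\<^esub> y) = \<phi> x \<otimes>\<^bsub>B\<^esub> \<phi> y"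
    and comp: "\<And>g. g \<in> carrier G \<Longrightarrow> \<phi> ` \<Gamma> g = \<Delta> g"
    by (rule graded_isomorphicE [OF iso]) blast
  let ?\<psi> = "inv_into (carrier A) \<phi>"
  have \<psi>: "?\<psi> x \<in> carrier A" "\<phi> (?\<psi> x) = x" if "x \<in> carrier B" for x
    using that bij by (auto simp: bij_betw_def inv_into_into f_inv_into_f)
  have \<psi>_eq: "?\<psi> (\<phi> x) = x" if "x \<in> carrier A" for x
    using that bij by (simp add: bij_betw_inv_into_left)
  \<comment> \<open>The scalar ring \<open>ring_of_type_algebra\<close> has the whole type as its
    carrier, so closure holds for every scalar of the type.\<close>
  have smult_carrier: "c \<odot>\<^bsub>A\<^esub> x \<in> carrier A" if "x \<in> carrier A" for c x
    using that smult_closed by (simp add: ring_of_type_algebra_def)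
  have "?\<psi> (x \<oplus>\<^bsub>B\<^esub> y) = ?\<psi> x \<oplus>\<^bsub>A\<^esub> ?\<psi> y" if "x \<in> carrier B" "y \<in> carrier B" for x y
    using that \<psi> \<psi>_eq add [of "?\<psi> x" "?\<psi> y"] by (metis M.a_closed)
  moreover have "?\<psi> (x \<otimes>\<^bsub>B\<^esub> y) = ?\<psi> x \<otimes>\<^bsub>A\<^esub> ?\<psi> y" if "x \<in> carrier B" "y \<in> carrier B" for x y
    using that \<psi> \<psi>_eq mult [of "?\<psi> x" "?\<psi> y"] by (metis mult_closed)
  moreover have "?\<psi> (c \<odot>\<^bsub>B\<^esub> x) = c \<odot>\<^bsub>A\<^esub> ?\<psi> x" if "x \<in> carrier B" for c x
    using that \<psi> \<psi>_eq smult [of "?\<psi> x" c] smult_carrier by metis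
  moreover have "?\<psi> ` \<Delta> g = \<Gamma> g" if "g \<in> carrier G" for g
  proof -
    have "\<Gamma> g \<subseteq> carrier A"
      using component_submodule [OF that] by (rule submoduleE(1))
    then show ?thesis
      using comp [OF that] bij by (metis bij_betw_def inv_into_image_cancel)
  qed
  ultimately show ?thesis
    using bij_betw_inv_into [OF bij] unfolding graded_isomorphic_def by blast
qed

lemma graded_isomorphic_trans:
  assumes "graded_isomorphic G A \<Gamma> B \<Delta>" "graded_isomorphic G B \<Delta> C \<Lambda>"
  shows "graded_isomorphic G A \<Gamma> C \<Lambda>"
proof -
  obtain \<phi> where \<phi>: "bij_betw \<phi> (carrier A) (carrier B)"
    "\<And>x y. x \<in> carrier A \<Longrightarrow> y \<in> carrier A \<Longrightarrow> \<phi> (x \<oplus>\<^bsub>A\<^esub> y) = \<phi> x \<oplus>\<^bsub>B\<^esub> \<phi> y"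
    "\<And>c x. x \<in> carrier A \<Longrightarrow> \<phi> (c \<odot>\<^bsub>A\<^esub> x) = c \<odot>\<^bsub>B\<^esub> \<phi> x"
    "\<And>x y. x \<in> carrier A \<Longrightarrow> y \<in> carrier A \<Longrightarrow> \<phi> (x \<otimes>\<^bsub>A\<^esub> y) = \<phi> x \<otimes>\<^bsub>B\<^esub> \<phi> y"
    "\<And>g. g \<in> carrier G \<Longrightarrow> \<phi> ` \<Gamma> g = \<Delta> g"
    by (rule graded_isomorphicE [OF assms(1)]) blast
  obtain \<psi> where \<psi>: "bij_betw \<psi> (carrier B) (carrier C)"
    "\<And>x y. x \<in> carrier B \<Longrightarrow> y \<in> carrier B \<Longrightarrow> \<psi> (x \<oplus>\<^bsub>B\<^esub> y) = \<psi> x \<oplus>\<^bsub>C\<^esub> \<psi> y"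
    "\<And>c x. x \<in> carrier B \<Longrightarrow> \<psi> (c \<odot>\<^bsub>B\<^esub> x) = c \<odot>\<^bsub>C\<^esub> \<psi> x"
    "\<And>x y. x \<in> carrier B \<Longrightarrow> y \<in> carrier B \<Longrightarrow> \<psi> (x \<otimes>\<^bsub>B\<^esub> y) = \<psi> x \<otimes>\<^bsub>C\<^esub> \<psi> y"
    "\<And>g. g \<in> carrier G \<Longrightarrow> \<psi> ` \<Delta> g = \<Lambda> g"
    by (rule graded_isomorphicE [OF assms(2)]) blast
  have "\<phi> x \<in> carrier B" if "x \<in> carrier A" for x
    using \<phi>(1) that by (rule bij_betwE [THEN bspec])
  then show ?thesis
    using \<phi> \<psi> bij_betw_trans [OF \<phi>(1) \<psi>(1)] unfolding graded_isomorphic_def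
    by (intro exI [of _ "\<psi> \<circ> \<phi>"] conjI) (simp_all flip: image_image)
qed

theorem proposition3p1:
  fixes G :: "('g, 'm) monoid_scheme"
    and A :: "('f::{alg_closed_field, field_char_0}, 'a) module" and \<Gamma> :: "'g \<Rightarrow> 'a set"
    and B :: "('f, 'b) module" and \<Delta> :: "'g \<Rightarrow> 'b set"
    and H\<^sub>A H\<^sub>B :: "'g set" and \<alpha> \<beta> :: "'g \<Rightarrow> 'g \<Rightarrow> 'f" and ps qs :: "'g list"
  assumes "group G"
    and "simple_graded_algebra G A \<Gamma>" and "finite_dimensional A"
    and "simple_graded_algebra G B \<Delta>" and "finite_dimensional B"
    and "is_presentation G A \<Gamma> (H\<^sub>A, \<alpha>, ps)"
    and "is_presentation G B \<Delta> (H\<^sub>B, \<beta>, qs)"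
    and "graded_isomorphic G A \<Gamma> B \<Delta>"
  shows "equivalent_presentations G (H\<^sub>A, \<alpha>, ps) (H\<^sub>B, \<beta>, qs)"
proof -
  interpret A: twisted_matrix G H\<^sub>A \<alpha> ps
    using assms(1,6) by (intro twisted_matrix.intro twisted_matrix_axioms.intro) auto
  interpret B: twisted_matrix G H\<^sub>B \<beta> qs
    using assms(1,7) by (intro twisted_matrix.intro twisted_matrix_axioms.intro) auto
  \<comment> \<open>The isomorphism \<open>\<theta>\<close> is composed of three: from the first
    concrete algebra back to \<open>A\<close>, across to \<open>B\<close>, and on to the second
    concrete algebra.\<close>
  have "graded_isomorphic G A.C (twisted_matrix_grading G H\<^sub>A \<alpha> ps) A \<Gamma>"
    using assms(2,6) by (auto simp: simple_graded_algebra_def intro: graded_isomorphic_sym)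
  moreover have "graded_isomorphic G B \<Delta> B.C (twisted_matrix_grading G H\<^sub>B \<beta> qs)"
    using assms(7) by simp
  ultimately have "graded_isomorphic G A.C A.component B.C B.component"
    using assms(8) graded_isomorphic_trans
    unfolding A.twisted_matrix_grading_eq [abs_def] B.twisted_matrix_grading_eq [abs_def]
    by metis
  then obtain \<theta> where "twisted_matrix_iso_axioms G H\<^sub>A \<alpha> ps H\<^sub>B \<beta> qs \<theta>"
    by (elim graded_isomorphicE) (rule that, rule twisted_matrix_iso_axioms.intro)
  then have "twisted_matrix_iso G H\<^sub>A \<alpha> ps H\<^sub>B \<beta> qs \<theta>"
    using A.twisted_matrix_axioms B.twisted_matrix_axioms by (intro twisted_matrix_iso.intro)
  moreover have "ps \<noteq> []"
    using assms(6) by auto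
  ultimately show ?thesis
    by (rule twisted_matrix_iso_imp_equivalent)
qed

end
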